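(* Let $G=(V,E)$ be a finite directed graph in which every vertex has at least one incoming edge and at least one outgoing edge, and suppose that $G$ does not have multi-edges. Let $N_0=|V|$. Let $\varphi:D_G^E\to D_G^V$ be the factor code induced by the $1$-block map $\varPhi:E\cup E^*\to V\cup V^*$ given by $\varPhi(e)=s(e)\in V$ for $e\in E$ and $\varPhi(e^* )=t(e^* )\,(=s(e))\in V^*$ for $e^*\in E^*$. For $x=(x_n)_{n\in\mathbb Z}\in D_G^E$ we have: (i) if $x$ does not have a minimum vertex, then $\varphi$ is injective at $x$, that is, $\varphi^{-1}(\varphi(x))=\{x\}$; (ii) if $x$ has a minimum vertex, then $|\varphi^{-1}(\varphi(x))|\le N_0=|V|$. Therefore $\varphi:D_G^E\to D_G^V$ is a finite-to-one factor code.
   Context: Markov-Dyck shift of a matrix. Let $A=[A(i,j)]_{i,j=1}^{M}$ be a $\{0,1\}$-matrix with no zero row and no zero column. Let $\mathcal O_A$ be the Cuntz-Krieger algebra, i.e. the universal $C^*$-algebra generated by partial isometries $t_1,\dots,t_M$ subject to $\sum_{j=1}^M t_jt_j^*=1$ and $t_i^*t_i=\sum_{j=1}^M A(i,j)t_jt_j^*$ for $i=1,\dots,M$. Let $\Sigma^-=\{\alpha_1,\dots,\alpha_M\}$, $\Sigma^+=\{\beta_1,\dots,\beta_M\}$, $\Sigma=\Sigma^-\cup\Sigma^+$ (disjoint), and $\varphi_A(\alpha_i)=t_i^*$, $\varphi_A(\beta_i)=t_i$. A word $\gamma_1\cdots\gamma_n$ over $\Sigma$ is forbidden if $\varphi_A(\gamma_1)\cdots\varphi_A(\gamma_n)=0$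 in $\mathcal O_A$. The Markov-Dyck shift $D_A\subset\Sigma^{\mathbb Z}$ is the subshift of all bi-infinite sequences containing no forbidden word. Graphs. For a finite directed graph $G=(V,E)$ with $V=\{v_1,\dots,v_{N_0}\}$, $E=\{e_1,\dots,e_{N_1}\}$, where $s(e)$ and $t(e)$ denote the initial and final vertex of $e$, the edge matrix $A^G$ is the $N_1\times N_1$ matrix with $A^G(i,j)=1$ if $t(e_i)=s(e_j)$ and $0$ otherwise; the vertex matrix $A_G$ is the $N_0\times N_0$ matrix with $A_G(i,j)=1$ if there is an edge from $v_i$ to $v_j$ and $0$ otherwise. $D_G^E:=D_{A^G}$ (Markov-Dyck shift of edge type) and $D_G^V:=D_{A_G}$ (of vertex type). Let $G^*=(V^*,E^* )$ be the transposed graph, with $e^*$ the reversal of $e$ ($s(e^* )=t(e)$, $t(e^* )=s(e)$) and $v^*$ the vertex corresponding to $v$. For $D_G^E$ one identifies $\alpha_i=e_i^*$, $\beta_i=e_i$, so the alphabet is $\Sigma^-\cup\Sigma^+=E^*\cup E$; for $D_G^V$ one identifies $\alpha_i=v_i^*$, $\beta_i=v_i$, so the alphabet is $V^*\cup V$ (as symbols, $V$ and $V^*$ are disjoint). A factor code is a surjective sliding block code. Height function. For $x\in D_G^E$ put $\chi_-(x_k)=1,\chi_+(x_k)=0$ if $x_k\in E^*$ and $\chi_-(x_k)=0,\chi_+(x_k)=1$ if $x_k\in E$. Set $H_0(x)=0$, and for $m\ge1$: $H_m(x)=\sum_{k=0}^{m-1}(\chi_-(x_k)-\chi_+(x_k))$,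 $H_{-m}(x)=\sum_{k=-m}^{-1}(-\chi_-(x_k)+\chi_+(x_k))$. The vertex $t(x_{m-1})=s(x_m)$ is called a minimum in $x$ if $H_m(x)\le H_n(x)$ for all $n\in\mathbb Z$; $x$ has a minimum vertex if such an $m\in\mathbb Z$ exists. *)

theory Defs
  imports
    Complex_Main
    "HOL-Library.Poly_Mapping"
    "Graph_Theory.Digraph"
begin

section \<open>Universal C*-algebras of generators and relations\<close>

subsection \<open>The free unital *-algebra\<close>

datatype 'g star_letter = Gen 'g | Adj 'g

text \<open>
  The free monoid on the generators and their formal adjoints, written additively because the
  convolution product of \<^type>\<open>poly_mapping\<close> asks for an additive monoid of exponents.
\<close>

datatype 'g star_monom = Monom (letters: "'g star_letter list")

instantiation star_monom :: (type) monoid_add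
begin

definition zero_star_monom :: "'a star_monom" where
  "0 = Monom []"

definition plus_star_monom :: "'a star_monom \<Rightarrow> 'a star_monom \<Rightarrow> 'a star_monom" where
  "u + v = Monom (letters u @ letters v)"

instance
  by standard (simp_all add: zero_star_monom_def plus_star_monom_def)

end

type_synonym 'g star_poly = "'g star_monom \<Rightarrow>\<^sub>0 complex"

definition gen :: "'g \<Rightarrow> 'g star_poly" where
  "gen g = Poly_Mapping.single (Monom [Gen g]) 1"

definition scale_poly :: "complex \<Rightarrow> 'g star_poly \<Rightarrow> 'g star_poly" where
  "scale_poly c x = Poly_Mapping.single 0 c * x"

fun adj_letter :: "'g star_letter \<Rightarrow> 'g star_letter" where
  "adj_letter (Gen g) = Adj g"
| "adj_letter (Adj g) = Gen g"

definition adj_monom :: "'g star_monom \<Rightarrow> 'g star_monom" where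
  "adj_monom w = Monom (rev (map adj_letter (letters w)))"

definition adj_poly :: "'g star_poly \<Rightarrow> 'g star_poly" where
  "adj_poly x = (\<Sum>w\<in>Poly_Mapping.keys x.
     Poly_Mapping.single (adj_monom w) (cnj (Poly_Mapping.lookup x w)))"


subsection \<open>Completion in the largest C*-seminorm\<close>

definition cstar_seminorm :: "('g star_poly \<Rightarrow> real) \<Rightarrow> bool" where
  "cstar_seminorm p \<longleftrightarrow>
     (\<forall>x. 0 \<le> p x) \<and>
     (\<forall>x y. p (x + y) \<le> p x + p y) \<and>
     (\<forall>c x. p (scale_poly c x) = cmod c * p x) \<and>
     (\<forall>x y. p (x * y) \<le> p x * p y) \<and>
     (\<forall>x. p (adj_poly x * x) = (p x)\<^sup>2)"

text \<open>
  A set \<open>R\<close> of *-polynomials stands for the relations \<open>r = 0\<close> with \<open>r \<in> R\<close>.  The universal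
  C*-algebra of \<open>R\<close> is the Hausdorff completion of the free *-algebra with respect to the
  supremum of all C*-seminorms that vanish on \<open>R\<close>.  It exists if that supremum is finite on
  every generator, as is the case if \<open>R\<close> forces the generators to be partial isometries.
  Its elements are classes of Cauchy sequences, on which the algebra operations act termwise;
  only the product and the adjoint are spelled out.
\<close>

definition univ_norm :: "'g star_poly set \<Rightarrow> 'g star_poly \<Rightarrow> real" where
  "univ_norm R x = (SUP p \<in> {p. cstar_seminorm p \<and> (\<forall>r\<in>R. p r = 0)}. p x)"

definition univ_Cauchy :: "'g star_poly set \<Rightarrow> (nat \<Rightarrow> 'g star_poly) set" where
  "univ_Cauchy R =
     {X. \<forall>\<epsilon>>0. \<exists>N. \<forall>m\<ge>N. \<forall>n\<ge>N. univ_norm R (X m - X n) < \<epsilon>}"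

definition univ_rel :: "'g star_poly set \<Rightarrow> ((nat \<Rightarrow> 'g star_poly) \<times> (nat \<Rightarrow> 'g star_poly)) set" where
  "univ_rel R = {(X, Y). X \<in> univ_Cauchy R \<and> Y \<in> univ_Cauchy R \<and>
     (\<lambda>n. univ_norm R (X n - Y n)) \<longlonglongrightarrow> 0}"

type_synonym 'g univ_elem = "(nat \<Rightarrow> 'g star_poly) set"

definition univ_cstar :: "'g star_poly set \<Rightarrow> 'g univ_elem set" where
  "univ_cstar R = univ_Cauchy R // univ_rel R"

definition univ_of :: "'g star_poly set \<Rightarrow> 'g star_poly \<Rightarrow> 'g univ_elem" where
  "univ_of R x = univ_rel R `` {\<lambda>_. x}"

definition univ_mult :: "'g star_poly set \<Rightarrow> 'g univ_elem \<Rightarrow> 'g univ_elem \<Rightarrow> 'g univ_elem" where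
  "univ_mult R a b = (\<Union>X\<in>a. \<Union>Y\<in>b. univ_rel R `` {\<lambda>n. X n * Y n})"

definition univ_adj :: "'g star_poly set \<Rightarrow> 'g univ_elem \<Rightarrow> 'g univ_elem" where
  "univ_adj R a = (\<Union>X\<in>a. univ_rel R `` {\<lambda>n. adj_poly (X n)})"


section \<open>Cuntz-Krieger algebras\<close>

text \<open>
  Matrices are indexed by a finite set \<open>I\<close>.  The last family of relations removes the generators
  of the ambient type that are not indexed by \<open>I\<close>.
\<close>

definition ck_relations :: "'i set \<Rightarrow> ('i \<Rightarrow> 'i \<Rightarrow> nat) \<Rightarrow> 'i star_poly set" where
  "ck_relations I A =
     {gen i * adj_poly (gen i) * gen i - gen i | i. i \<in> I} \<union>
     {(\<Sum>j\<in>I. gen j * adj_poly (gen j)) - 1} \<union>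
     {adj_poly (gen i) * gen i - (\<Sum>j\<in>I. of_nat (A i j) * (gen j * adj_poly (gen j))) | i. i \<in> I} \<union>
     {gen i | i. i \<notin> I}"

definition cuntz_krieger :: "'i set \<Rightarrow> ('i \<Rightarrow> 'i \<Rightarrow> nat) \<Rightarrow> 'i univ_elem set" where
  "cuntz_krieger I A = univ_cstar (ck_relations I A)"

definition ck_gen :: "'i set \<Rightarrow> ('i \<Rightarrow> 'i \<Rightarrow> nat) \<Rightarrow> 'i \<Rightarrow> 'i univ_elem" where
  "ck_gen I A i = univ_of (ck_relations I A) (gen i)"

definition ck_zero :: "'i set \<Rightarrow> ('i \<Rightarrow> 'i \<Rightarrow> nat) \<Rightarrow> 'i univ_elem" where
  "ck_zero I A = univ_of (ck_relations I A) 0"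

definition ck_one :: "'i set \<Rightarrow> ('i \<Rightarrow> 'i \<Rightarrow> nat) \<Rightarrow> 'i univ_elem" where
  "ck_one I A = univ_of (ck_relations I A) 1"

definition ck_mult ::
    "'i set \<Rightarrow> ('i \<Rightarrow> 'i \<Rightarrow> nat) \<Rightarrow> 'i univ_elem \<Rightarrow> 'i univ_elem \<Rightarrow> 'i univ_elem" where
  "ck_mult I A = univ_mult (ck_relations I A)"

definition ck_adj :: "'i set \<Rightarrow> ('i \<Rightarrow> 'i \<Rightarrow> nat) \<Rightarrow> 'i univ_elem \<Rightarrow> 'i univ_elem" where
  "ck_adj I A = univ_adj (ck_relations I A)"


section \<open>Subshifts and Markov-Dyck shifts\<close>

definition block :: "(int \<Rightarrow> 'a) \<Rightarrow> int \<Rightarrow> int \<Rightarrow> 'a list" where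
  "block x i j = map x [i..j]"

definition subshift :: "'a set \<Rightarrow> 'a list set \<Rightarrow> (int \<Rightarrow> 'a) set" where
  "subshift S F = {x. range x \<subseteq> S \<and> (\<forall>i j. i \<le> j \<longrightarrow> block x i j \<notin> F)}"

definition sliding_block_code ::
    "(int \<Rightarrow> 'a) set \<Rightarrow> (int \<Rightarrow> 'b) set \<Rightarrow> ((int \<Rightarrow> 'a) \<Rightarrow> int \<Rightarrow> 'b) \<Rightarrow> bool" where
  "sliding_block_code X Y f \<longleftrightarrow> f ` X \<subseteq> Y \<and>
     (\<exists>(m::nat) (a::nat) \<Phi>. \<forall>x\<in>X. \<forall>k. f x k = \<Phi> (block x (k - int m) (k + int a)))"

definition factor_code ::
    "(int \<Rightarrow> 'a) set \<Rightarrow> (int \<Rightarrow> 'b) set \<Rightarrow> ((int \<Rightarrow> 'a) \<Rightarrow> int \<Rightarrow> 'b) \<Rightarrow> bool" where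
  "factor_code X Y f \<longleftrightarrow> sliding_block_code X Y f \<and> f ` X = Y"

definition fiber :: "('a \<Rightarrow> 'b) \<Rightarrow> 'a set \<Rightarrow> 'b \<Rightarrow> 'a set" where
  "fiber f X y = {x \<in> X. f x = y}"

text \<open>The fibers of a finite-to-one code are required to be uniformly bounded in size.\<close>

definition finite_to_one :: "'a set \<Rightarrow> 'b set \<Rightarrow> ('a \<Rightarrow> 'b) \<Rightarrow> bool" where
  "finite_to_one X Y f \<longleftrightarrow>
     (\<exists>K. \<forall>y\<in>Y. finite (fiber f X y) \<and> card (fiber f X y) \<le> K)"

datatype 'i dyck_symbol = Alpha 'i | Beta 'i

definition dyck_alphabet :: "'i set \<Rightarrow> 'i dyck_symbol set" where
  "dyck_alphabet I = Alpha ` I \<union> Beta ` I"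

fun dyck_op :: "'i set \<Rightarrow> ('i \<Rightarrow> 'i \<Rightarrow> nat) \<Rightarrow> 'i dyck_symbol \<Rightarrow> 'i univ_elem" where
  "dyck_op I A (Alpha i) = ck_adj I A (ck_gen I A i)"
| "dyck_op I A (Beta i) = ck_gen I A i"

definition dyck_forbidden :: "'i set \<Rightarrow> ('i \<Rightarrow> 'i \<Rightarrow> nat) \<Rightarrow> 'i dyck_symbol list set" where
  "dyck_forbidden I A = {w \<in> lists (dyck_alphabet I).
     w \<noteq> [] \<and> foldr (ck_mult I A) (map (dyck_op I A) w) (ck_one I A) = ck_zero I A}"

definition markov_dyck :: "'i set \<Rightarrow> ('i \<Rightarrow> 'i \<Rightarrow> nat) \<Rightarrow> (int \<Rightarrow> 'i dyck_symbol) set" where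
  "markov_dyck I A = subshift (dyck_alphabet I) (dyck_forbidden I A)"


section \<open>Markov-Dyck shifts of graphs\<close>

definition edge_matrix :: "('v, 'e) pre_digraph \<Rightarrow> 'e \<Rightarrow> 'e \<Rightarrow> nat" where
  "edge_matrix G e f = (if head G e = tail G f then 1 else 0)"

definition vertex_matrix :: "('v, 'e) pre_digraph \<Rightarrow> 'v \<Rightarrow> 'v \<Rightarrow> nat" where
  "vertex_matrix G u v = (if \<exists>e\<in>arcs G. tail G e = u \<and> head G e = v then 1 else 0)"

definition edge_shift :: "('v, 'e) pre_digraph \<Rightarrow> (int \<Rightarrow> 'e dyck_symbol) set" where
  "edge_shift G = markov_dyck (arcs G) (edge_matrix G)"

definition vertex_shift :: "('v, 'e) pre_digraph \<Rightarrow> (int \<Rightarrow> 'v dyck_symbol) set" where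
  "vertex_shift G = markov_dyck (verts G) (vertex_matrix G)"

text \<open>
  In the shift of edge type, \<open>Beta e\<close> is the edge \<open>e\<close> and \<open>Alpha e\<close> is its reversal in the
  transposed graph; in the shift of vertex type, \<open>Beta v\<close> is \<open>v\<close> and \<open>Alpha v\<close> is \<open>v\<^sup>*\<close>.
\<close>

fun initial_vertex :: "('v, 'e) pre_digraph \<Rightarrow> 'e dyck_symbol \<Rightarrow> 'v" where
  "initial_vertex G (Beta e) = tail G e"
| "initial_vertex G (Alpha e) = head G e"

fun final_vertex :: "('v, 'e) pre_digraph \<Rightarrow> 'e dyck_symbol \<Rightarrow> 'v" where
  "final_vertex G (Beta e) = head G e"
| "final_vertex G (Alpha e) = tail G e"

fun edge_to_vertex :: "('v, 'e) pre_digraph \<Rightarrow> 'e dyck_symbol \<Rightarrow> 'v dyck_symbol" where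
  "edge_to_vertex G (Beta e) = Beta (initial_vertex G (Beta e))"
| "edge_to_vertex G (Alpha e) = Alpha (final_vertex G (Alpha e))"

definition edge_to_vertex_code ::
    "('v, 'e) pre_digraph \<Rightarrow> (int \<Rightarrow> 'e dyck_symbol) \<Rightarrow> int \<Rightarrow> 'v dyck_symbol" where
  "edge_to_vertex_code G x = (\<lambda>n. edge_to_vertex G (x n))"


subsection \<open>Height function and minimum vertices\<close>

fun chi_minus :: "'e dyck_symbol \<Rightarrow> int" where
  "chi_minus (Alpha e) = 1"
| "chi_minus (Beta e) = 0"

fun chi_plus :: "'e dyck_symbol \<Rightarrow> int" where
  "chi_plus (Alpha e) = 0"
| "chi_plus (Beta e) = 1"

definition height :: "(int \<Rightarrow> 'e dyck_symbol) \<Rightarrow> int \<Rightarrow> int" where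
  "height x m =
     (if 0 \<le> m then (\<Sum>k = 0..<m. chi_minus (x k) - chi_plus (x k))
      else (\<Sum>k = m..<0. - chi_minus (x k) + chi_plus (x k)))"

text \<open>
  For \<open>x\<close> in the shift of edge type, \<open>initial_vertex G (x m)\<close> is also
  \<open>final_vertex G (x (m - 1))\<close>.
\<close>

definition minimum_vertices :: "('v, 'e) pre_digraph \<Rightarrow> (int \<Rightarrow> 'e dyck_symbol) \<Rightarrow> 'v set" where
  "minimum_vertices G x = {initial_vertex G (x m) | m. \<forall>n. height x m \<le> height x n}"

definition has_minimum_vertex :: "('v, 'e) pre_digraph \<Rightarrow> (int \<Rightarrow> 'e dyck_symbol) \<Rightarrow> bool" where
  "has_minimum_vertex G x \<longleftrightarrow> minimum_vertices G x \<noteq> {}"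

end

theory Submission
  imports Defs "HOL-Analysis.L2_Norm"
begin

text \<open>
  The Cuntz-Krieger algebra enters only through the set of forbidden words, so the first task is
  to replace it by combinatorics.  Let a symbol act on infinite paths of the matrix \<open>A\<close>: \<open>Beta i\<close>
  prepends \<open>i\<close> where the transition is allowed, and \<open>Alpha i\<close> removes an initial \<open>i\<close>.  A word is
  forbidden iff, read from right to left, it acts on no path at all (\<open>dyck_forbidden_iff\<close>).

  If a word acts on some path, it is nonzero in the algebra, because the shifts
  of the path space act on finitely supported functions on paths by partial isometries that satisfy
  the Cuntz-Krieger relations; the operator norm is then a C*-seminorm that does not vanish on the
  word.  Conversely, the relations rewrite the product of a word with a sufficiently long
  path \<open>t\<^sub>\<kappa>\<close> as the action predicts, so a word that acts nowhere kills every \<open>t\<^sub>\<kappa>\<close> and hence is zero,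
  since the ranges of the \<open>t\<^sub>i\<close> sum to 1.  This uses that \<open>t\<^sub>i\<^sup>* t\<^sub>j = 0\<close> for distinct \<open>i\<close>, \<open>j\<close>, that
  is, projections with sum 1 are orthogonal.  Rather than positivity in C*-algebras, the proof
  uses that a unit is an extreme point of the unit ball (\<open>unit_extreme\<close>).

  For a graph without multi-edges, an infinite edge path is determined by its sequence of
  tails, and this bijection onto vertex paths intertwines the two actions.  Hence legal edge words
  map to legal vertex words, every legal vertex word lifts, and a compactness argument
  lifts bi-infinite sequences.

  For the fibres, read a sequence \<open>x\<close> as a walk on the vertices of the graph, with its height
  function.  The code keeps the heights and, at each step, the vertex at the upper
  end of the step.  If the walk returns to a height without having gone below it, the word read in
  between acts as the identity, so the walk is back at the same vertex (\<open>return_vertex\<close>).  Consequently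
  a vertex is determined by the image unless its height is a global minimum: wait until the walk
  first goes below that height, and look at the upper end of that step.  All positions of minimal
  height carry one common vertex, which is the only information that the code can lose.
\<close>

section \<open>The free *-algebra\<close>

lemma poly_mapping_induct_plus [case_names zero plus]:
  fixes x :: "'a \<Rightarrow>\<^sub>0 'b::comm_monoid_add"
  assumes "P 0" and "\<And>x w c. P x \<Longrightarrow> P (x + Poly_Mapping.single w c)"
  shows "P x"
proof (induction x rule: update_induct)
  case const
  then show ?case using assms(1) by simp
next
  case (update f a b)
  have "Poly_Mapping.update a b f = f + Poly_Mapping.single a b"
    using update(1) by (intro poly_mapping_eqI)
      (auto simp: lookup_update lookup_add lookup_single when_def in_keys_iff)
  then show ?case using assms(2) update by simp
qed

lemma adj_letter_invol [simp]: "adj_letter (adj_letter l) = l"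
  by (cases l) auto

lemma adj_monom_invol [simp]: "adj_monom (adj_monom w) = w"
  by (cases w) (simp add: adj_monom_def rev_map comp_def)

lemma adj_monom_plus: "adj_monom (u + v) = adj_monom v + adj_monom u"
  by (simp add: adj_monom_def plus_star_monom_def)

lemma adj_monom_zero [simp]: "adj_monom 0 = 0"
  by (simp add: adj_monom_def zero_star_monom_def)

lemma lookup_adj_poly:
  "Poly_Mapping.lookup (adj_poly x) w = cnj (Poly_Mapping.lookup x (adj_monom w))"
proof -
  have "Poly_Mapping.lookup (adj_poly x) w =
      (\<Sum>u\<in>Poly_Mapping.keys x. if u = adj_monom w then cnj (Poly_Mapping.lookup x u) else 0)"
    unfolding adj_poly_def lookup_sum
    by (intro sum.cong refl) (auto simp: lookup_single when_def)
  also have "\<dots> = cnj (Poly_Mapping.lookup x (adj_monom w))"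
    by (simp add: in_keys_iff)
  finally show ?thesis .
qed

lemma adj_poly_add: "adj_poly (x + y) = adj_poly x + adj_poly y"
  by (rule poly_mapping_eqI) (simp add: lookup_adj_poly lookup_add)

lemma adj_poly_minus: "adj_poly (x - y) = adj_poly x - adj_poly y"
  by (rule poly_mapping_eqI) (simp add: lookup_adj_poly lookup_minus)

lemma adj_poly_0 [simp]: "adj_poly 0 = 0"
  by (rule poly_mapping_eqI) (simp add: lookup_adj_poly)

lemma adj_poly_invol [simp]: "adj_poly (adj_poly x) = x"
  by (rule poly_mapping_eqI) (simp add: lookup_adj_poly)

lemma adj_poly_single:
  "adj_poly (Poly_Mapping.single w c) = Poly_Mapping.single (adj_monom w) (cnj c)"
  by (rule poly_mapping_eqI) (auto simp: lookup_adj_poly lookup_single when_def)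

lemma adj_poly_1 [simp]: "adj_poly 1 = 1"
  using adj_poly_single[of 0 1] by simp

lemma adj_poly_mult: "adj_poly (x * y) = adj_poly y * adj_poly x"
proof (induction x rule: poly_mapping_induct_plus)
  case (plus x w c)
  have "adj_poly (Poly_Mapping.single w c * y) = adj_poly y * adj_poly (Poly_Mapping.single w c)"
    by (induction y rule: poly_mapping_induct_plus)
      (simp_all add: algebra_simps adj_poly_add adj_poly_single mult_single adj_monom_plus)
  with plus show ?case by (simp add: algebra_simps adj_poly_add)
qed simp

lemma adj_poly_gen: "adj_poly (gen i) = Poly_Mapping.single (Monom [Adj i]) 1"
  by (simp add: gen_def adj_poly_single adj_monom_def)

lemma lookup_scale_poly:
  "Poly_Mapping.lookup (scale_poly c x) w = c * Poly_Mapping.lookup x w"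
  by (simp add: scale_poly_def Poly_Mapping.map.rep_eq when_def flip: mult_map_scale_conv_mult)

lemma scale_poly_add: "scale_poly c (x + y) = scale_poly c x + scale_poly c y"
  by (simp add: scale_poly_def algebra_simps)

lemma single_0_commute:
  fixes x :: "('a::monoid_add) \<Rightarrow>\<^sub>0 complex"
  shows "Poly_Mapping.single 0 c * x = x * Poly_Mapping.single 0 c"
  by (induction x rule: poly_mapping_induct_plus) (simp_all add: algebra_simps mult_single)

lemma mult_scale_poly_right: "x * scale_poly c y = scale_poly c (x * y)"
  by (metis single_0_commute scale_poly_def mult.assoc)

lemma mult_scale_poly_left: "scale_poly c x * y = scale_poly c (x * y)"
  by (simp add: scale_poly_def mult.assoc)

lemma scale_poly_of_nat: "scale_poly (of_nat k) x = of_nat k * x"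
  by (simp add: scale_poly_def)

lemma scale_poly_1 [simp]: "scale_poly 1 x = x"
  by (simp add: scale_poly_def)

lemma scale_poly_scale: "scale_poly a (scale_poly b x) = scale_poly (a * b) x"
  by (simp add: scale_poly_def mult.assoc[symmetric] mult_single)

lemma scale_poly_add_left: "scale_poly (a + b) x = scale_poly a x + scale_poly b x"
  by (simp add: scale_poly_def single_add algebra_simps)

lemma scale_poly_neg: "scale_poly (- a) x = - scale_poly a x"
  by (simp add: scale_poly_def single_uminus)

section \<open>C*-seminorms\<close>

text \<open>
  The inequality \<open>(p x)\<^sup>2 \<le> p (adj_poly x * x)\<close> is enough for the C*-identity: with submultiplicativity
  it gives \<open>p x \<le> p (adj_poly x)\<close>, hence equality by symmetry, hence the reverse inequality.
\<close>

lemma cstar_seminormI: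
  assumes nonneg: "\<And>x. 0 \<le> p x"
    and triangle: "\<And>x y. p (x + y) \<le> p x + p y"
    and scale_le: "\<And>c x. p (scale_poly c x) \<le> cmod c * p x"
    and submult: "\<And>x y. p (x * y) \<le> p x * p y"
    and cstar_ge: "\<And>x. (p x)\<^sup>2 \<le> p (adj_poly x * x)"
  shows "cstar_seminorm p"
proof -
  have scale: "p (scale_poly c x) = cmod c * p x" for c x
  proof (cases "c = 0")
    case False
    have "p x \<le> cmod (inverse c) * p (scale_poly c x)"
      using scale_le[of "inverse c" "scale_poly c x"] False by (simp add: scale_poly_scale)
    then have "cmod c * p x \<le> p (scale_poly c x)"
      using False by (simp add: norm_inverse norm_divide field_simps)
    then show ?thesis using scale_le[of c x] by simp
  qed (use scale_le[of 0 x] nonneg[of "scale_poly 0 x"] in simp)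
  have adj_le: "p x \<le> p (adj_poly x)" for x
  proof (cases "p x = 0")
    case False
    have "p x * p x \<le> p (adj_poly x) * p x"
      using order_trans[OF cstar_ge[of x] submult] by (simp add: power2_eq_square)
    then show ?thesis using False nonneg[of x] by auto
  qed (simp add: nonneg)
  have "p (adj_poly x * x) = (p x)\<^sup>2" for x
  proof (rule antisym)
    have "p (adj_poly x) = p x"
      using adj_le[of x] adj_le[of "adj_poly x"] by simp
    then show "p (adj_poly x * x) \<le> (p x)\<^sup>2"
      using submult[of "adj_poly x" x] by (simp add: power2_eq_square)
  qed (rule cstar_ge)
  then show ?thesis
    unfolding cstar_seminorm_def using nonneg triangle scale submult by blast
qed

locale cstar =
  fixes p :: "'g star_poly \<Rightarrow> real"
  assumes cstar: "cstar_seminorm p"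
begin

lemma nonneg: "0 \<le> p x"
  and triangle: "p (x + y) \<le> p x + p y"
  and scale: "p (scale_poly c x) = cmod c * p x"
  and submult: "p (x * y) \<le> p x * p y"
  and cstar_id: "p (adj_poly x * x) = (p x)\<^sup>2"
  using cstar unfolding cstar_seminorm_def by blast+

lemma zero [simp]: "p 0 = 0"
  using scale[of 0 0] by (simp add: scale_poly_def)

lemma minus [simp]: "p (- x) = p x"
  using scale[of "-1" x] by (simp add: scale_poly_neg)

lemma diff_commute: "p (x - y) = p (y - x)"
  using minus[of "x - y"] by simp

lemma triangle_diff: "p (x - z) \<le> p (x - y) + p (y - z)"
  using triangle[of "x - y" "y - z"] by simp

lemma diff_le: "p (x - y) \<le> p x + p y"
  using triangle[of x "- y"] by simp

lemma le_add_diff: "p x \<le> p y + p (y - x)"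
  using triangle[of y "x - y"] diff_commute[of x y] by simp

lemma sum_le: "p (sum f A) \<le> (\<Sum>i\<in>A. p (f i))"
  by (induction A rule: infinite_finite_induct) (auto intro: order_trans[OF triangle])

lemma adj_le: "p x \<le> p (adj_poly x)"
proof (cases "p x = 0")
  case False
  have "p x * p x \<le> p (adj_poly x) * p x"
    using submult[of "adj_poly x" x] cstar_id[of x] by (simp add: power2_eq_square)
  then show ?thesis using False nonneg[of x] by auto
qed (simp add: nonneg)

lemma adj [simp]: "p (adj_poly x) = p x"
  using adj_le[of x] adj_le[of "adj_poly x"] by simp

lemma projection_le_1:
  assumes "p (adj_poly x * x - x) = 0"
  shows "p x \<le> 1"
proof -
  have "(p x)\<^sup>2 \<le> p x"
    using le_add_diff[of "adj_poly x * x" x] diff_commute[of x "adj_poly x * x"] assms cstar_id[of x]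
    by simp
  then show ?thesis
    using nonneg[of x] by (cases "p x = 0") (auto simp: power2_eq_square)
qed

lemma one_le_1: "p 1 \<le> 1"
  by (rule projection_le_1) simp

text \<open>
  Equality modulo the kernel of \<open>p\<close>.  The kernel is a two-sided *-ideal, so the relations of an
  algebra can be used as rewrite rules for \<open>\<approx>\<close>.
\<close>

definition eqv :: "'g star_poly \<Rightarrow> 'g star_poly \<Rightarrow> bool" (infix \<open>\<approx>\<close> 50) where
  "x \<approx> y \<longleftrightarrow> p (x - y) = 0"

lemma eqv_refl [simp]: "x \<approx> x"
  by (simp add: eqv_def)

lemma eqv_sym: "x \<approx> y \<Longrightarrow> y \<approx> x"
  by (simp add: eqv_def diff_commute)

lemma eqv_trans [trans]: "x \<approx> y \<Longrightarrow> y \<approx> z \<Longrightarrow> x \<approx> z"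
  unfolding eqv_def using triangle_diff[of x z y] nonneg[of "x - z"] by simp

lemma eqv_add: "x \<approx> x' \<Longrightarrow> y \<approx> y' \<Longrightarrow> x + y \<approx> x' + y'"
  unfolding eqv_def using triangle[of "x - x'" "y - y'"] nonneg[of "x + y - (x' + y')"]
  by (simp add: algebra_simps)

lemma eqv_minus: "x \<approx> x' \<Longrightarrow> y \<approx> y' \<Longrightarrow> x - y \<approx> x' - y'"
  unfolding eqv_def using diff_le[of "x - x'" "y - y'"] nonneg[of "x - y - (x' - y')"]
  by (simp add: algebra_simps)

lemma eqv_sum: "(\<And>i. i \<in> A \<Longrightarrow> f i \<approx> g i) \<Longrightarrow> sum f A \<approx> sum g A"
  by (induction A rule: infinite_finite_induct) (auto intro: eqv_add)

lemma eqv_mult: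
  assumes "x \<approx> x'" "y \<approx> y'"
  shows "x * y \<approx> x' * y'"
proof -
  have l: "u * z \<approx> v * z" if "u \<approx> v" for u v z
    using that submult[of "u - v" z] nonneg[of "(u - v) * z"]
    by (simp add: eqv_def algebra_simps)
  have r: "z * u \<approx> z * v" if "u \<approx> v" for u v z
    using that submult[of z "u - v"] nonneg[of "z * (u - v)"]
    by (simp add: eqv_def algebra_simps)
  show ?thesis using l r assms eqv_trans by blast
qed

lemma eqv_adj: "x \<approx> y \<Longrightarrow> adj_poly x \<approx> adj_poly y"
  unfolding eqv_def by (metis adj adj_poly_minus)

lemma eqv_scale: "x \<approx> y \<Longrightarrow> scale_poly c x \<approx> scale_poly c y"
  unfolding scale_poly_def by (intro eqv_mult eqv_refl)

lemma eqv_norm: "x \<approx> y \<Longrightarrow> p x = p y"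
  unfolding eqv_def using le_add_diff[of x y] le_add_diff[of y x] diff_commute[of x y] by simp

lemma eqv_zero_iff: "x \<approx> 0 \<longleftrightarrow> p x = 0"
  by (simp add: eqv_def)

lemma mult_eqv_zero: "x \<approx> 0 \<Longrightarrow> x * y \<approx> 0" "y \<approx> 0 \<Longrightarrow> x * y \<approx> 0"
  using eqv_mult[of x 0 y y] eqv_mult[of x x y 0] by simp_all

lemma partial_isometry_le_1:
  assumes "t * adj_poly t * t \<approx> t"
  shows "p t \<le> 1"
proof -
  let ?q = "adj_poly t * t"
  have "adj_poly ?q * ?q = adj_poly t * (t * adj_poly t * t)"
    by (simp add: adj_poly_mult mult.assoc)
  also have "\<dots> \<approx> ?q" by (intro eqv_mult eqv_refl assms)
  finally have "p ?q \<le> 1" by (intro projection_le_1) (simp add: eqv_def)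
  then show ?thesis by (simp add: cstar_id abs_square_le_1 nonneg)
qed

text \<open>
  A bound that depends on the coefficients alone: it makes the supremum of all
  C*-seminorms that are contractive on the generators finite.
\<close>

lemma norm_le_coeffs:
  assumes "\<And>g. p (gen g) \<le> 1"
  shows "p x \<le> (\<Sum>w\<in>Poly_Mapping.keys x. cmod (Poly_Mapping.lookup x w))"
proof -
  have mono: "p (Poly_Mapping.single (Monom ls) 1) \<le> 1" for ls
  proof (induction ls)
    case Nil
    show ?case using one_le_1 by (simp flip: zero_star_monom_def)
  next
    case (Cons l ls)
    have "Poly_Mapping.single (Monom (l # ls)) (1::complex) =
        Poly_Mapping.single (Monom [l]) 1 * Poly_Mapping.single (Monom ls) 1"
      by (simp add: mult_single plus_star_monom_def)
    moreover have "p (Poly_Mapping.single (Monom [l]) 1) \<le> 1"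
      using assms adj[of "gen (case l of Gen g \<Rightarrow> g | Adj g \<Rightarrow> g)"]
      by (cases l) (simp_all add: gen_def adj_poly_single adj_monom_def del: adj)
    ultimately show ?case
      using submult Cons by (metis mult_le_one nonneg order_trans)
  qed
  have "p (Poly_Mapping.single w c) \<le> cmod c" for w c
  proof -
    have "p (Poly_Mapping.single w c) = cmod c * p (Poly_Mapping.single w 1)"
      using scale[of c "Poly_Mapping.single w 1"] by (simp add: scale_poly_def mult_single)
    also have "\<dots> \<le> cmod c"
      using mono[of "letters w"] by (simp add: mult_left_le)
    finally show ?thesis .
  qed
  moreover have "x = (\<Sum>w\<in>Poly_Mapping.keys x. Poly_Mapping.single w (Poly_Mapping.lookup x w))"
    by (intro poly_mapping_eqI) (simp add: lookup_sum lookup_single when_def in_keys_iff)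
  ultimately show ?thesis
    by (metis (no_types, lifting) sum_le sum_mono order_trans)
qed

text \<open>
  A unit \<open>e\<close> of a corner is an extreme point of its unit ball.  The averages
  \<open>2 ((M + 1) x + c e) = (e + x) (M x + (c + 1) e) + (e - x) (M x + (c - 1) e)\<close> and concavity of the
  square root give \<open>p (M x + c e) \<le> sqrt (c\<^sup>2 + M)\<close> by induction on \<open>M\<close>.  For \<open>c = 0\<close> this says
  \<open>p x \<le> 1 / sqrt M\<close> for every \<open>M\<close>.
\<close>

lemma unit_extreme:
  assumes e: "e * e \<approx> e" "e * x \<approx> x" "x * e \<approx> x"
    and le: "p e \<le> 1" "p (e + x) \<le> 1" "p (e - x) \<le> 1"
  shows "x \<approx> 0"
proof -
  define f where "f M c = scale_poly (of_nat M) x + scale_poly (of_real c) e" for M :: nat and c :: real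
  have bound: "p (f M c) \<le> sqrt (c\<^sup>2 + real M)" for M c
  proof (induction M arbitrary: c)
    case 0
    have "p (f 0 c) = \<bar>c\<bar> * p e"
      by (simp add: f_def scale scale_poly_def[of 0])
    also have "\<dots> \<le> \<bar>c\<bar>" using le(1) nonneg[of e] by (simp add: mult_left_le)
    finally show ?case by simp
  next
    case (Suc M)
    have ef: "e * f M d \<approx> f M d" for d
      unfolding f_def distrib_left mult_scale_poly_right
      by (intro eqv_add eqv_scale e)
    let ?F = "f M (c + 1)" and ?G = "f M (c - 1)"
    have diff: "?F - ?G = scale_poly 2 e"
      by (rule poly_mapping_eqI)
        (simp add: f_def lookup_add lookup_minus lookup_scale_poly algebra_simps)
    have "(e + x) * ?F + (e - x) * ?G = e * ?F + e * ?G + x * (?F - ?G)"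
      by (simp add: algebra_simps)
    also have "\<dots> = e * ?F + e * ?G + scale_poly 2 (x * e)"
      by (simp add: diff mult_scale_poly_right)
    also have "\<dots> \<approx> ?F + ?G + scale_poly 2 x"
      by (intro eqv_add eqv_scale ef e)
    also have "\<dots> = scale_poly 2 (f (Suc M) c)"
      by (rule poly_mapping_eqI)
        (simp add: f_def lookup_add lookup_minus lookup_scale_poly algebra_simps)
    finally have "2 * p (f (Suc M) c) = p ((e + x) * ?F + (e - x) * ?G)"
      using eqv_norm scale[of 2] by simp
    also have "\<dots> \<le> p (e + x) * p ?F + p (e - x) * p ?G"
      by (rule order_trans[OF triangle add_mono[OF submult submult]])
    also have "\<dots> \<le> p ?F + p ?G"
      using le nonneg by (intro add_mono) (auto intro: mult_left_le_one_le)
    also have "\<dots> \<le> sqrt ((c + 1)\<^sup>2 + real M) + sqrt ((c - 1)\<^sup>2 + real M)"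
      by (intro add_mono Suc.IH)
    also have "\<dots> \<le> 2 * sqrt (c\<^sup>2 + real (Suc M))"
    proof -
      define a b where "a = sqrt ((c + 1)\<^sup>2 + real M)" and "b = sqrt ((c - 1)\<^sup>2 + real M)"
      have ab: "a\<^sup>2 = (c + 1)\<^sup>2 + real M" "b\<^sup>2 = (c - 1)\<^sup>2 + real M"
        by (simp_all add: a_def b_def)
      have "(a + b)\<^sup>2 \<le> 2 * (a\<^sup>2 + b\<^sup>2)"
        using zero_le_power2[of "a - b"] by (simp add: power2_eq_square algebra_simps)
      also have "\<dots> = 4 * (c\<^sup>2 + real (Suc M))"
        unfolding ab by (simp add: power2_eq_square algebra_simps)
      finally have "a + b \<le> sqrt (4 * (c\<^sup>2 + real (Suc M)))"
        by (rule real_le_rsqrt)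
      then show ?thesis unfolding real_sqrt_mult real_sqrt_four a_def b_def .
    qed
    finally show ?case by simp
  qed
  have "real M * (p x)\<^sup>2 \<le> 1" for M
  proof (cases "M = 0")
    case False
    have "(real M * p x)\<^sup>2 \<le> real M"
      using bound[of M 0] nonneg[of x]
      by (simp add: f_def scale scale_poly_def[of 0] real_le_rsqrt sqrt_ge_absD)
    then show ?thesis using False by (simp add: power2_eq_square mult.left_commute)
  qed simp
  then have "(p x)\<^sup>2 \<le> 0"
    by (metis not_le real_archimedian_rdiv_eq_0 zero_le_one zero_le_power2 order_refl mult.commute)
  then show ?thesis by (simp add: eqv_zero_iff)
qed

end

section \<open>The completion in the largest C*-seminorm\<close>

lemma cstar_seminorm_zero: "cstar_seminorm (\<lambda>_. 0)"
  by (simp add: cstar_seminorm_def)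

definition admissible_norms :: "'g star_poly set \<Rightarrow> ('g star_poly \<Rightarrow> real) set" where
  "admissible_norms R = {p. cstar_seminorm p \<and> (\<forall>r\<in>R. p r = 0)}"

lemma cstarI: "p \<in> admissible_norms R \<Longrightarrow> cstar p"
  by (simp add: admissible_norms_def cstar_def)

lemma null_comparison:
  fixes f g :: "nat \<Rightarrow> real"
  assumes "g \<longlonglongrightarrow> 0" "\<And>n. f n \<le> g n" "\<And>n. 0 \<le> f n"
  shows "f \<longlonglongrightarrow> 0"
  using assms by (intro real_tendsto_sandwich[OF _ _ tendsto_const assms(1)]) auto

text \<open>
  The supremum that defines \<^const>\<open>univ_norm\<close> is finite, hence itself a C*-seminorm, as
  soon as the relations bound the generators.
\<close>

locale contractive_relations =
  fixes R :: "'g star_poly set"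
  assumes contractive: "p \<in> admissible_norms R \<Longrightarrow> p (gen g) \<le> 1"
begin

lemma bdd: "bdd_above ((\<lambda>p. p x) ` admissible_norms R)"
  by (rule bdd_aboveI2) (rule cstar.norm_le_coeffs[OF cstarI contractive])

lemma univ_norm_eq: "univ_norm R x = (SUP p\<in>admissible_norms R. p x)"
  by (simp add: univ_norm_def admissible_norms_def)

lemma le_univ_norm: "p \<in> admissible_norms R \<Longrightarrow> p x \<le> univ_norm R x"
  unfolding univ_norm_eq by (rule cSUP_upper[OF _ bdd])

lemma zero_admissible: "(\<lambda>_. 0) \<in> admissible_norms R"
  by (simp add: admissible_norms_def cstar_seminorm_zero)

lemma univ_norm_le: "(\<And>p. p \<in> admissible_norms R \<Longrightarrow> p x \<le> c) \<Longrightarrow> univ_norm R x \<le> c"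
  unfolding univ_norm_eq using zero_admissible by (intro cSUP_least) auto

lemma univ_norm_admissible: "univ_norm R \<in> admissible_norms R"
proof -
  have nonneg: "0 \<le> univ_norm R x" for x
    using le_univ_norm[OF zero_admissible] .
  have vanish: "univ_norm R r = 0" if "r \<in> R" for r
    using that by (intro antisym univ_norm_le nonneg) (simp add: admissible_norms_def)
  have "cstar_seminorm (univ_norm R)"
  proof (rule cstar_seminormI)
    show "univ_norm R (scale_poly c x) \<le> cmod c * univ_norm R x" for c x
      by (rule univ_norm_le) (simp add: cstar.scale[OF cstarI] le_univ_norm mult_left_mono)
    show "univ_norm R (x + y) \<le> univ_norm R x + univ_norm R y" for x y
      by (rule univ_norm_le, rule order_trans[OF cstar.triangle[OF cstarI]])
        (auto intro: add_mono le_univ_norm)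
    show "univ_norm R (x * y) \<le> univ_norm R x * univ_norm R y" for x y
      by (rule univ_norm_le, rule order_trans[OF cstar.submult[OF cstarI]])
        (auto intro: mult_mono le_univ_norm nonneg cstar.nonneg[OF cstarI])
    show "(univ_norm R x)\<^sup>2 \<le> univ_norm R (adj_poly x * x)" for x
    proof -
      have "p x \<le> sqrt (univ_norm R (adj_poly x * x))" if "p \<in> admissible_norms R" for p
        using le_univ_norm[OF that, of "adj_poly x * x"] cstar.cstar_id[OF cstarI[OF that]]
        by (simp add: real_le_rsqrt)
      then have "univ_norm R x \<le> sqrt (univ_norm R (adj_poly x * x))"
        by (rule univ_norm_le)
      then show ?thesis
        using nonneg by (metis power_mono real_sqrt_pow2)
    qed
  qed (rule nonneg)
  then show ?thesis using vanish by (simp add: admissible_norms_def)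
qed

sublocale N: cstar "univ_norm R"
  by (rule cstarI[OF univ_norm_admissible])

lemma limit_imp_Cauchy:
  assumes "(\<lambda>n. univ_norm R (x - X n)) \<longlonglongrightarrow> 0"
  shows "X \<in> univ_Cauchy R"
  unfolding univ_Cauchy_def
proof (intro CollectI allI impI)
  fix \<epsilon> :: real assume "0 < \<epsilon>"
  then have "\<forall>\<^sub>F n in sequentially. univ_norm R (x - X n) < \<epsilon> / 2"
    by (intro order_tendstoD(2)[OF assms]) simp
  then obtain K where K: "\<And>n. K \<le> n \<Longrightarrow> univ_norm R (x - X n) < \<epsilon> / 2"
    by (auto simp: eventually_sequentially)
  have "univ_norm R (X m - X n) < \<epsilon>" if "K \<le> m" "K \<le> n" for m n
    using K[OF that(1)] K[OF that(2)] N.triangle_diff[of "X m" "X n" x] N.diff_commute[of x "X m"]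
    by simp
  then show "\<exists>K. \<forall>m\<ge>K. \<forall>n\<ge>K. univ_norm R (X m - X n) < \<epsilon>" by blast
qed

lemma mem_univ_of: "X \<in> univ_of R x \<longleftrightarrow> (\<lambda>n. univ_norm R (x - X n)) \<longlonglongrightarrow> 0"
  using limit_imp_Cauchy[of x X] limit_imp_Cauchy[of x "\<lambda>_. x"]
  by (auto simp: univ_of_def univ_rel_def)

lemma univ_of_eq_iff: "univ_of R x = univ_of R y \<longleftrightarrow> univ_norm R (x - y) = 0"
proof
  assume "univ_of R x = univ_of R y"
  then have "(\<lambda>_. y) \<in> univ_of R x" by (simp add: mem_univ_of)
  then show "univ_norm R (x - y) = 0" by (simp add: mem_univ_of LIMSEQ_const_iff)
next
  assume "univ_norm R (x - y) = 0"
  then have "univ_norm R (x - z) = univ_norm R (y - z)" for z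
    using N.triangle_diff[of x z y] N.triangle_diff[of y z x] N.diff_commute[of x y] by simp
  then show "univ_of R x = univ_of R y" by (auto simp: mem_univ_of)
qed

text \<open>
  A sequence that converges to a polynomial \<open>x\<close> represents the same element of the completion as the
  constant sequence \<open>x\<close>.  With it, the unions in the definitions of product and adjoint are unions
  over equal classes.
\<close>

lemma univ_rel_limit:
  assumes "(\<lambda>n. univ_norm R (x - X n)) \<longlonglongrightarrow> 0"
  shows "univ_rel R `` {X} = univ_of R x"
proof -
  have *: "(\<lambda>n. univ_norm R (X n - Y n)) \<longlonglongrightarrow> 0 \<longleftrightarrow> (\<lambda>n. univ_norm R (x - Y n)) \<longlonglongrightarrow> 0" for Y
  proof
    assume "(\<lambda>n. univ_norm R (X n - Y n)) \<longlonglongrightarrow> 0"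
    from tendsto_add[OF assms this, simplified]
    show "(\<lambda>n. univ_norm R (x - Y n)) \<longlonglongrightarrow> 0"
      by (rule null_comparison)
        (simp_all add: N.nonneg N.triangle_diff)
  next
    assume "(\<lambda>n. univ_norm R (x - Y n)) \<longlonglongrightarrow> 0"
    from tendsto_add[OF assms this, simplified]
    show "(\<lambda>n. univ_norm R (X n - Y n)) \<longlonglongrightarrow> 0"
      by (rule null_comparison)
        (simp_all add: N.nonneg N.triangle_diff[of "X _" "Y _" x] N.diff_commute[of x "X _"])
  qed
  show ?thesis
    using limit_imp_Cauchy[OF assms] limit_imp_Cauchy[of x]
    by (auto simp: mem_univ_of univ_rel_def *)
qed

lemma univ_mult_of: "univ_mult R (univ_of R x) (univ_of R y) = univ_of R (x * y)"
proof -
  have "univ_rel R `` {\<lambda>n. X n * Y n} = univ_of R (x * y)"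
    if "X \<in> univ_of R x" "Y \<in> univ_of R y" for X Y
  proof (rule univ_rel_limit)
    have X: "(\<lambda>n. univ_norm R (x - X n)) \<longlonglongrightarrow> 0" and Y: "(\<lambda>n. univ_norm R (y - Y n)) \<longlonglongrightarrow> 0"
      using that by (simp_all add: mem_univ_of)
    define b where "b n = univ_norm R (x - X n) * univ_norm R y
        + (univ_norm R x + univ_norm R (x - X n)) * univ_norm R (y - Y n)" for n
    have "b \<longlonglongrightarrow> 0 * univ_norm R y + (univ_norm R x + 0) * 0"
      unfolding b_def by (intro tendsto_intros X Y)
    then have "b \<longlonglongrightarrow> 0" by simp
    moreover have "univ_norm R (x * y - X n * Y n) \<le> b n" for n
    proof -
      have "x * y - X n * Y n = (x - X n) * y + X n * (y - Y n)" by (simp add: algebra_simps)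
      then have "univ_norm R (x * y - X n * Y n)
          \<le> univ_norm R (x - X n) * univ_norm R y + univ_norm R (X n) * univ_norm R (y - Y n)"
        using order_trans[OF N.triangle add_mono[OF N.submult N.submult]] by simp
      also have "\<dots> \<le> b n"
        unfolding b_def using N.le_add_diff[of "X n" x]
        by (intro add_left_mono mult_right_mono N.nonneg)
      finally show ?thesis .
    qed
    ultimately show "(\<lambda>n. univ_norm R (x * y - X n * Y n)) \<longlonglongrightarrow> 0"
      by (rule null_comparison) (simp_all add: N.nonneg)
  qed
  moreover have "(\<lambda>_. x) \<in> univ_of R x" "(\<lambda>_. y) \<in> univ_of R y"
    by (simp_all add: mem_univ_of)
  ultimately show ?thesis unfolding univ_mult_def by blast
qed

lemma univ_adj_of: "univ_adj R (univ_of R x) = univ_of R (adj_poly x)"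
proof -
  have "univ_rel R `` {\<lambda>n. adj_poly (X n)} = univ_of R (adj_poly x)" if "X \<in> univ_of R x" for X
    using that by (intro univ_rel_limit) (simp add: mem_univ_of flip: adj_poly_minus)
  moreover have "(\<lambda>_. x) \<in> univ_of R x" by (simp add: mem_univ_of)
  ultimately show ?thesis unfolding univ_adj_def by blast
qed

end

section \<open>Words modulo the Cuntz-Krieger relations\<close>

context cstar
begin

text \<open>
  In the corner of \<open>e = P i\<close>, the elements \<open>q k = e * P k * e\<close> with \<open>k \<noteq> i\<close> sum to 0, and each \<open>e - q k\<close> is a
  contraction.  So \<open>q j\<close> is minus the sum of the remaining \<open>q k\<close>, and for the number \<open>n\<close> of all
  projections both \<open>e + q j / n\<close> and \<open>e - q j / n\<close> are averages of contractions.  Extremality of \<open>e\<close>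
  yields \<open>q j = 0\<close>, and \<open>q j\<close> is the square of \<open>P j * e\<close> in the sense of the C*-identity.
\<close>

lemma projections_orthogonal:
  assumes "finite J" "(\<Sum>j\<in>J. P j) \<approx> 1"
    and self_adjoint: "\<And>j. j \<in> J \<Longrightarrow> adj_poly (P j) = P j"
    and idem: "\<And>j. j \<in> J \<Longrightarrow> P j * P j \<approx> P j"
    and ij: "i \<in> J" "j \<in> J" "i \<noteq> j"
  shows "P j * P i \<approx> 0"
proof -
  define e where "e = P i"
  define q where "q k = e * P k * e" for k
  define S where "S = J - {i, j}"
  define n where "n = real (card S + 2)"
  \<comment> \<open>The factor \<open>1 / n\<close> makes \<open>e \<plusminus> x\<close> averages of \<open>n\<close> contractions.\<close>
  define x where "x = scale_poly (complex_of_real (1 / n)) (q j)"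
  have n: "n > 0" by (simp add: n_def)
  have e: "e * e \<approx> e" and p_e: "p e \<le> 1"
    using idem[OF ij(1)] self_adjoint[OF ij(1)] projection_le_1[of e] by (auto simp: e_def eqv_def)
  have d: "p (e - q k) \<le> 1" if "k \<in> J" for k
  proof -
    have "p (1 - P k) \<le> 1"
      using idem[OF that] self_adjoint[OF that] diff_commute[of "P k"]
      by (intro projection_le_1) (simp add: adj_poly_minus eqv_def algebra_simps)
    then have "p (e * (1 - P k) * e) \<le> 1"
      by (meson p_e submult nonneg mult_le_one order_trans)
    moreover have "e * (1 - P k) * e = e * e - q k" by (simp add: q_def algebra_simps)
    then have "e * (1 - P k) * e \<approx> e - q k" by (simp add: e eqv_minus)
    ultimately show ?thesis using eqv_norm by simp
  qed
  have qj: "q j \<approx> - sum q S"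
  proof -
    have "sum q J = e * sum P J * e"
      by (simp add: q_def sum_distrib_left sum_distrib_right)
    also have "\<dots> \<approx> e * 1 * e"
      by (intro eqv_mult assms eqv_refl)
    also have "\<dots> \<approx> e" using e by simp
    finally have J: "sum q J \<approx> e" .
    have "q i = e * e * e" by (simp add: q_def e_def)
    also have "\<dots> \<approx> e * e" by (intro eqv_mult e eqv_refl)
    also have "\<dots> \<approx> e" by (rule e)
    finally have "q i \<approx> e" .
    moreover have "sum q J = q i + q j + sum q S"
    proof -
      have "sum q J = q i + sum q (J - {i})"
        using ij assms(1) by (intro sum.remove)
      also have "sum q (J - {i}) = q j + sum q (J - {i} - {j})"
        using ij assms(1) by (intro sum.remove) auto
      finally show ?thesis by (simp add: S_def Diff_insert2[of J i "{j}"] add.assoc)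
    qed
    ultimately have "sum q J - q i - sum q S \<approx> e - e - sum q S"
      using J by (intro eqv_minus eqv_refl)
    moreover have "sum q J - q i - sum q S = q j"
      using \<open>sum q J = q i + q j + sum q S\<close> by simp
    ultimately show ?thesis by simp
  qed
  have "x \<approx> 0"
  proof (rule unit_extreme[OF e _ _ p_e])
    have "e * q j = e * e * P j * e" "q j * e = e * P j * (e * e)"
      by (simp_all add: q_def mult.assoc)
    then have "e * q j \<approx> q j" "q j * e \<approx> q j"
      unfolding q_def using e by (simp_all add: eqv_mult)
    then show "e * x \<approx> x" "x * e \<approx> x"
      by (simp_all add: x_def mult_scale_poly_right mult_scale_poly_left eqv_scale)
  next
    have "scale_poly (complex_of_real n) (e + x) = scale_poly (complex_of_real n) e + q j"
      using n by (simp add: x_def scale_poly_add scale_poly_scale flip: of_real_mult)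
    also have "\<dots> \<approx> scale_poly (complex_of_real n) e + - sum q S"
      by (intro eqv_add eqv_refl qj)
    also have "\<dots> = (\<Sum>k\<in>S. e - q k) + scale_poly 2 e"
      by (simp add: n_def sum_subtractf scale_poly_add_left flip: scale_poly_of_nat)
    finally have "n * p (e + x) = p ((\<Sum>k\<in>S. e - q k) + scale_poly 2 e)"
      using n eqv_norm scale by (metis norm_of_real abs_of_pos)
    also have "\<dots> \<le> (\<Sum>k\<in>S. p (e - q k)) + 2 * p e"
      by (rule order_trans[OF triangle]) (simp add: scale sum_le)
    also have "\<dots> \<le> n"
      using sum_mono[of S "\<lambda>k. p (e - q k)" "\<lambda>_. 1"] d p_e by (simp add: S_def n_def)
    finally show "p (e + x) \<le> 1" using n by simp
  next
    have "scale_poly (complex_of_real n) (e - x) = (e - q j) + scale_poly (complex_of_real (n - 1)) e"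
      using n by (intro poly_mapping_eqI)
        (simp add: x_def lookup_add lookup_minus lookup_scale_poly algebra_simps)
    then have "n * p (e - x) = p ((e - q j) + scale_poly (complex_of_real (n - 1)) e)"
      using n scale by (metis norm_of_real abs_of_pos)
    also have "\<dots> \<le> p (e - q j) + (n - 1) * p e"
      using triangle[of "e - q j" "scale_poly (complex_of_real (n - 1)) e"]
      unfolding scale norm_of_real by (simp add: n_def)
    also have "\<dots> \<le> 1 + (n - 1) * 1"
      using d[OF ij(2)] p_e by (intro add_mono mult_left_mono) (simp_all add: n_def)
    finally show "p (e - x) \<le> 1" using n by simp
  qed
  then have "scale_poly (complex_of_real n) x \<approx> scale_poly (complex_of_real n) 0"
    by (rule eqv_scale)
  then have "q j \<approx> 0"
    using n by (simp add: x_def scale_poly_scale scale_poly_def[of _ 0] flip: of_real_mult)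
  have "adj_poly (P j * e) * (P j * e) = e * (P j * P j) * e"
    using self_adjoint[OF ij(1)] self_adjoint[OF ij(2)] by (simp add: e_def adj_poly_mult mult.assoc)
  also have "\<dots> \<approx> q j"
    unfolding q_def by (intro eqv_mult eqv_refl idem ij)
  also have "q j \<approx> 0" by fact
  finally show ?thesis by (simp add: eqv_zero_iff cstar_id e_def)
qed

end

fun dyck_poly :: "'i dyck_symbol \<Rightarrow> 'i star_poly" where
  "dyck_poly (Alpha i) = adj_poly (gen i)"
| "dyck_poly (Beta i) = gen i"

definition word_poly :: "'i dyck_symbol list \<Rightarrow> 'i star_poly" where
  "word_poly w = prod_list (map dyck_poly w)"

lemma word_poly_simps [simp]:
  "word_poly [] = 1" "word_poly (s # w) = dyck_poly s * word_poly w"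
  by (simp_all add: word_poly_def)

definition infinite_paths :: "'i set \<Rightarrow> ('i \<Rightarrow> 'i \<Rightarrow> nat) \<Rightarrow> (nat \<Rightarrow> 'i) set" where
  "infinite_paths I A = {x. \<forall>n. x n \<in> I \<and> A (x n) (x (Suc n)) = 1}"

text \<open>
  Left multiplication by a generator or its adjoint, read on the indices of a product
  \<open>t\<^sub>x\<^sub>0 t\<^sub>x\<^sub>1 \<dots>\<close> of generators along a path \<open>x\<close>.
\<close>

fun dyck_step :: "'i set \<Rightarrow> ('i \<Rightarrow> 'i \<Rightarrow> nat) \<Rightarrow> 'i dyck_symbol \<Rightarrow> (nat \<Rightarrow> 'i) \<Rightarrow> (nat \<Rightarrow> 'i) option" where
  "dyck_step I A (Beta i) x = (if i \<in> I \<and> A i (x 0) = 1 then Some (case_nat i x) else None)"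
| "dyck_step I A (Alpha i) x = (if x 0 = i then Some (x \<circ> Suc) else None)"

text \<open>
  The rightmost symbol acts first, as in a product of operators.
\<close>

fun dyck_act :: "'i set \<Rightarrow> ('i \<Rightarrow> 'i \<Rightarrow> nat) \<Rightarrow> 'i dyck_symbol list \<Rightarrow> (nat \<Rightarrow> 'i) \<Rightarrow> (nat \<Rightarrow> 'i) option" where
  "dyck_act I A [] x = Some x"
| "dyck_act I A (s # w) x = Option.bind (dyck_act I A w x) (dyck_step I A s)"

lemma case_nat_paths: "case_nat i x \<in> infinite_paths I A \<longleftrightarrow> i \<in> I \<and> A i (x 0) = 1 \<and> x \<in> infinite_paths I A"
  unfolding infinite_paths_def by (auto split: nat.split dest: spec[of _ 0] spec[of _ "Suc _"])

lemma step_paths: "x \<in> infinite_paths I A \<Longrightarrow> dyck_step I A s x = Some y \<Longrightarrow> y \<in> infinite_paths I A"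
  by (cases s) (auto simp: case_nat_paths split: if_splits, auto simp: infinite_paths_def)

lemma act_paths: "x \<in> infinite_paths I A \<Longrightarrow> dyck_act I A w x = Some y \<Longrightarrow> y \<in> infinite_paths I A"
  by (induction w arbitrary: y) (auto simp: bind_eq_Some_conv intro: step_paths)

primrec path_poly :: "(nat \<Rightarrow> 'i) \<Rightarrow> nat \<Rightarrow> 'i star_poly" where
  "path_poly x 0 = 1"
| "path_poly x (Suc n) = gen (x 0) * path_poly (x \<circ> Suc) n"

locale ck_matrix =
  fixes I :: "'i set" and A :: "'i \<Rightarrow> 'i \<Rightarrow> nat"
  assumes finite_I: "finite I"
    and zero_one: "A i j \<in> {0, 1}"
    and row: "i \<in> I \<Longrightarrow> \<exists>j\<in>I. A i j = 1"
begin

lemma path_from: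
  assumes "i \<in> I"
  shows "\<exists>x\<in>infinite_paths I A. x 0 = i"
proof -
  have "\<exists>x. \<forall>n. (x n \<in> I \<and> (n = 0 \<longrightarrow> x n = i)) \<and> A (x n) (x (Suc n)) = 1"
    by (rule dependent_nat_choice[where P = "\<lambda>n y. y \<in> I \<and> (n = 0 \<longrightarrow> y = i)"
          and Q = "\<lambda>n y z. A y z = 1"]) (use assms row in auto)
  then show ?thesis by (auto simp: infinite_paths_def)
qed

end

locale ck_norm = ck_matrix + cstar p for p +
  assumes admissible: "p \<in> admissible_norms (ck_relations I A)"
begin

lemma kernel: "r \<in> ck_relations I A \<Longrightarrow> r \<approx> 0"
  using admissible by (simp add: admissible_norms_def eqv_zero_iff)

lemma gen_outside: "i \<notin> I \<Longrightarrow> gen i \<approx> 0"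
  by (rule kernel) (auto simp: ck_relations_def)

lemma partial_isometry: "gen i * adj_poly (gen i) * gen i \<approx> gen i"
proof (cases "i \<in> I")
  case True
  then have "gen i * adj_poly (gen i) * gen i - gen i \<approx> 0"
    by (intro kernel) (auto simp: ck_relations_def)
  then show ?thesis by (simp add: eqv_def)
next
  case False
  then show ?thesis
    using mult_eqv_zero(2)[of "gen i"] gen_outside eqv_sym eqv_trans by blast
qed

lemma partial_isometry_adj: "adj_poly (gen i) * gen i * adj_poly (gen i) \<approx> adj_poly (gen i)"
  using eqv_adj[OF partial_isometry[of i]] by (simp add: adj_poly_mult mult.assoc)

lemma sum_ranges: "(\<Sum>j\<in>I. gen j * adj_poly (gen j)) \<approx> 1"
proof -
  have "(\<Sum>j\<in>I. gen j * adj_poly (gen j)) - 1 \<approx> 0"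
    by (intro kernel) (auto simp: ck_relations_def)
  then show ?thesis by (simp add: eqv_def)
qed

lemma source_projection:
  assumes "i \<in> I"
  shows "adj_poly (gen i) * gen i \<approx> (\<Sum>j\<in>I. of_nat (A i j) * (gen j * adj_poly (gen j)))"
proof -
  have "adj_poly (gen i) * gen i - (\<Sum>j\<in>I. of_nat (A i j) * (gen j * adj_poly (gen j))) \<approx> 0"
    using assms by (intro kernel) (auto simp: ck_relations_def)
  then show ?thesis by (simp add: eqv_def)
qed

lemma orthogonal:
  assumes "i \<in> I" "j \<in> I" "i \<noteq> j"
  shows "adj_poly (gen i) * gen j \<approx> 0"
proof -
  let ?P = "\<lambda>k. gen k * adj_poly (gen k)"
  have idem: "?P k * ?P k \<approx> ?P k" for k
    using eqv_mult[OF partial_isometry[of k] eqv_refl[of "adj_poly (gen k)"]]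
    by (simp add: mult.assoc)
  have "?P i * ?P j \<approx> 0"
    using assms by (intro projections_orthogonal[OF finite_I sum_ranges _ idem])
      (auto simp: adj_poly_mult)
  have "adj_poly (gen i) * gen j \<approx> (adj_poly (gen i) * gen i * adj_poly (gen i)) * (gen j * adj_poly (gen j) * gen j)"
    by (intro eqv_sym[OF eqv_mult] partial_isometry partial_isometry_adj)
  also have "\<dots> = adj_poly (gen i) * (?P i * ?P j) * gen j"
    by (simp add: mult.assoc)
  also have "\<dots> \<approx> 0"
    by (rule mult_eqv_zero(1)[OF mult_eqv_zero(2)]) fact
  finally show ?thesis .
qed

text \<open>
  The source projection of \<open>t\<^sub>i\<close> is a sum of range projections, and by orthogonality only
  the range projection of \<open>t\<^sub>j\<close> survives in front of \<open>t\<^sub>j\<close>.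
\<close>

lemma source_gen:
  assumes "i \<in> I" "j \<in> I"
  shows "adj_poly (gen i) * gen i * gen j \<approx> of_nat (A i j) * gen j"
proof -
  have "adj_poly (gen i) * gen i * gen j \<approx> (\<Sum>k\<in>I. of_nat (A i k) * (gen k * adj_poly (gen k))) * gen j"
    by (intro eqv_mult source_projection assms eqv_refl)
  also have "\<dots> = (\<Sum>k\<in>I. of_nat (A i k) * (gen k * (adj_poly (gen k) * gen j)))"
    by (simp add: sum_distrib_right mult.assoc)
  also have "\<dots> \<approx> (\<Sum>k\<in>I. if k = j then of_nat (A i j) * gen j else 0)"
  proof (rule eqv_sum)
    fix k assume "k \<in> I"
    show "of_nat (A i k) * (gen k * (adj_poly (gen k) * gen j))
        \<approx> (if k = j then of_nat (A i j) * gen j else 0)"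
    proof (cases "k = j")
      case True
      have "of_nat (A i j) * (gen j * adj_poly (gen j) * gen j) \<approx> of_nat (A i j) * gen j"
        by (intro eqv_mult partial_isometry eqv_refl)
      then show ?thesis using True by (simp add: mult.assoc)
    next
      case False
      then show ?thesis
        using orthogonal \<open>k \<in> I\<close> assms by (simp add: mult_eqv_zero)
    qed
  qed
  also have "\<dots> = of_nat (A i j) * gen j"
    using assms finite_I by simp
  finally show ?thesis .
qed

lemma gen_mult_zero:
  assumes "i \<in> I" "j \<in> I" "A i j \<noteq> 1"
  shows "gen i * gen j \<approx> 0"
proof -
  have "gen i * gen j \<approx> gen i * adj_poly (gen i) * gen i * gen j"
    by (intro eqv_sym[OF eqv_mult] partial_isometry eqv_refl)
  also have "\<dots> = gen i * (adj_poly (gen i) * gen i * gen j)" by (simp add: mult.assoc)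
  also have "\<dots> \<approx> gen i * (of_nat (A i j) * gen j)"
    by (intro eqv_mult source_gen assms eqv_refl)
  also have "\<dots> = 0" using zero_one[of i j] assms by auto
  finally show ?thesis .
qed

text \<open>
  At least two letters are needed: cancelling \<open>t\<^sub>i\<^sup>* t\<^sub>i\<close> against a single letter leaves
  the source projection of \<open>t\<^sub>i\<close>, which is not a product of generators.
\<close>

lemma step_path_poly:
  assumes "x \<in> infinite_paths I A" "s \<in> dyck_alphabet I" "2 \<le> m"
  shows "case dyck_step I A s x of None \<Rightarrow> dyck_poly s * path_poly x m \<approx> 0
    | Some y \<Rightarrow> \<exists>k\<ge>m - 1. dyck_poly s * path_poly x m \<approx> path_poly y k"
proof -
  have I: "x n \<in> I" and edge: "A (x n) (x (Suc n)) = 1" for n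
    using assms(1) by (auto simp: infinite_paths_def)
  obtain k where m: "m = Suc (Suc k)" using assms(3) by (auto simp: numeral_2_eq_2 dest: Suc_le_D)
  show ?thesis
  proof (cases s)
    case (Beta i)
    then have i: "i \<in> I" using assms(2) by (auto simp: dyck_alphabet_def)
    show ?thesis
    proof (cases "A i (x 0) = 1")
      case True
      have "path_poly (case_nat i x) (Suc m) = gen i * path_poly x m"
        by (simp add: comp_def)
      then show ?thesis
        using Beta i True by (auto intro!: exI[of _ "Suc m"] simp del: path_poly.simps)
    next
      case False
      then have "gen i * gen (x 0) * path_poly (x \<circ> Suc) (Suc k) \<approx> 0"
        by (intro mult_eqv_zero gen_mult_zero i I)
      then show ?thesis using Beta False m by (simp add: mult.assoc)
    qed
  next
    case (Alpha i)
    then have i: "i \<in> I" using assms(2) by (auto simp: dyck_alphabet_def)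
    show ?thesis
    proof (cases "x 0 = i")
      case True
      have "adj_poly (gen i) * path_poly x m
          = adj_poly (gen i) * gen i * gen (x 1) * path_poly (x \<circ> Suc \<circ> Suc) k"
        using True by (simp add: m mult.assoc)
      also have "\<dots> \<approx> of_nat (A i (x 1)) * gen (x 1) * path_poly (x \<circ> Suc \<circ> Suc) k"
        by (intro eqv_mult source_gen I i eqv_refl)
      also have "\<dots> = path_poly (x \<circ> Suc) (m - 1)"
        using True edge[of 0] by (simp add: m)
      finally show ?thesis using Alpha True by auto
    next
      case False
      then have "adj_poly (gen i) * gen (x 0) * path_poly (x \<circ> Suc) (Suc k) \<approx> 0"
        by (intro mult_eqv_zero orthogonal i I) auto
      then show ?thesis using Alpha False m by (simp add: mult.assoc)
    qed
  qed
qed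

text \<open>
  A prefix that is longer than the word never runs out of letters, so the whole
  word acts on it by the rule for single steps.
\<close>

lemma act_path_poly:
  assumes "x \<in> infinite_paths I A" "w \<in> lists (dyck_alphabet I)" "length w < n"
  shows "case dyck_act I A w x of None \<Rightarrow> word_poly w * path_poly x n \<approx> 0
    | Some y \<Rightarrow> \<exists>k\<ge>n - length w. word_poly w * path_poly x n \<approx> path_poly y k"
  using assms(2,3)
proof (induction w)
  case Nil
  then show ?case by auto
next
  case (Cons s w)
  then have s: "s \<in> dyck_alphabet I" by simp
  show ?case
  proof (cases "dyck_act I A w x")
    case None
    then show ?thesis using Cons by (simp add: mult.assoc mult_eqv_zero)
  next
    case (Some y)
    then obtain k where k: "k \<ge> n - length w" "word_poly w * path_poly x n \<approx> path_poly y k"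
      using Cons by auto
    have "y \<in> infinite_paths I A" using act_paths assms(1) Some by metis
    moreover have "2 \<le> k" using k(1) Cons.prems by simp
    ultimately have st: "case dyck_step I A s y of None \<Rightarrow> dyck_poly s * path_poly y k \<approx> 0
        | Some z \<Rightarrow> \<exists>l\<ge>k - 1. dyck_poly s * path_poly y k \<approx> path_poly z l"
      using s by (intro step_path_poly)
    have eq: "word_poly (s # w) * path_poly x n \<approx> dyck_poly s * path_poly y k"
      using k(2) by (simp add: mult.assoc eqv_mult)
    show ?thesis
    proof (cases "dyck_step I A s y")
      case None
      then show ?thesis using Some st eq eqv_trans by (auto simp del: word_poly_simps)
    next
      case (Some z)
      then obtain l where "l \<ge> k - 1" "dyck_poly s * path_poly y k \<approx> path_poly z l"
        using st by auto
      moreover have "n - length (s # w) \<le> l" using \<open>l \<ge> k - 1\<close> k(1) by simp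
      ultimately show ?thesis
        using Some \<open>dyck_act I A w x = Some y\<close> eq eqv_trans by (auto simp del: word_poly_simps)
    qed
  qed
qed

lemma zero_if_kills_gens:
  assumes "\<And>i. i \<in> I \<Longrightarrow> z * gen i \<approx> 0"
  shows "z \<approx> 0"
proof -
  have "z * 1 \<approx> z * (\<Sum>i\<in>I. gen i * adj_poly (gen i))"
    by (intro eqv_mult eqv_sym[OF sum_ranges] eqv_refl)
  also have "\<dots> = (\<Sum>i\<in>I. z * gen i * adj_poly (gen i))"
    by (simp add: sum_distrib_left mult.assoc)
  also have "\<dots> \<approx> (\<Sum>i\<in>I. 0)"
    by (intro eqv_sum mult_eqv_zero assms)
  finally show ?thesis by simp
qed

text \<open>
  Peeling off one letter at a time with \<open>\<Sum>\<^sub>i t\<^sub>i t\<^sub>i\<^sup>* = 1\<close>.  A letter that cannot precede the path gives a zero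
  product anyway, and every letter starts some path because no row vanishes.
\<close>

lemma zero_if_kills_paths:
  assumes "\<And>x. x \<in> infinite_paths I A \<Longrightarrow> z * path_poly x (Suc n) \<approx> 0"
  shows "z \<approx> 0"
  using assms
proof (induction n arbitrary: z)
  case 0
  have "z * gen i \<approx> 0" if "i \<in> I" for i
    using path_from[OF that] 0 by force
  then show ?case by (rule zero_if_kills_gens)
next
  case (Suc n)
  have "z * gen i \<approx> 0" if i: "i \<in> I" for i
  proof (rule Suc.IH)
    fix x assume x: "x \<in> infinite_paths I A"
    show "z * gen i * path_poly x (Suc n) \<approx> 0"
    proof (cases "A i (x 0) = 1")
      case True
      then have "z * path_poly (case_nat i x) (Suc (Suc n)) \<approx> 0"
        using Suc.prems x i by (simp add: case_nat_paths del: path_poly.simps)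
      then show ?thesis by (simp add: comp_def mult.assoc)
    next
      case False
      moreover have "x 0 \<in> I" using x by (simp add: infinite_paths_def)
      ultimately have "z * (gen i * gen (x 0) * path_poly (x \<circ> Suc) n) \<approx> 0"
        using i by (intro mult_eqv_zero gen_mult_zero)
      then show ?thesis by (simp add: mult.assoc)
    qed
  qed
  then show ?case by (rule zero_if_kills_gens)
qed

lemma word_poly_zero:
  assumes "w \<in> lists (dyck_alphabet I)" "\<And>x. x \<in> infinite_paths I A \<Longrightarrow> dyck_act I A w x = None"
  shows "word_poly w \<approx> 0"
proof (rule zero_if_kills_paths)
  fix x assume "x \<in> infinite_paths I A"
  then show "word_poly w * path_poly x (Suc (length w)) \<approx> 0"
    using act_path_poly[OF _ assms(1), of x "Suc (length w)"] assms(2)[of x] by simp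
qed

lemma gen_le_1: "p (gen i) \<le> 1"
  by (rule partial_isometry_le_1[OF partial_isometry])

end

section \<open>Operators from partial injections\<close>

definition supp :: "('x \<Rightarrow> complex) \<Rightarrow> 'x set" where
  "supp f = {x. f x \<noteq> 0}"

text \<open>
  The pre-Hilbert space of finitely supported functions determines the operator norm of a bounded
  operator, by density.
\<close>

definition l2 :: "('x \<Rightarrow> complex) \<Rightarrow> real" where
  "l2 f = L2_set (\<lambda>x. cmod (f x)) (supp f)"

lemma l2_superset:
  assumes "finite S" "supp f \<subseteq> S"
  shows "l2 f = L2_set (\<lambda>x. cmod (f x)) S"
  unfolding l2_def L2_set_def using assms
  by (intro arg_cong[where f = sqrt] sum.mono_neutral_left) (auto simp: supp_def)

lemma l2_nonneg: "0 \<le> l2 f"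
  by (simp add: l2_def)

lemma l2_add:
  assumes "finite (supp f)" "finite (supp g)"
  shows "l2 (\<lambda>x. f x + g x) \<le> l2 f + l2 g"
proof -
  let ?S = "supp f \<union> supp g"
  have "l2 (\<lambda>x. f x + g x) = L2_set (\<lambda>x. cmod (f x + g x)) ?S"
    by (rule l2_superset) (use assms in \<open>auto simp: supp_def\<close>)
  also have "\<dots> \<le> L2_set (\<lambda>x. cmod (f x) + cmod (g x)) ?S"
    by (intro L2_set_mono norm_triangle_ineq) simp
  also have "\<dots> \<le> L2_set (\<lambda>x. cmod (f x)) ?S + L2_set (\<lambda>x. cmod (g x)) ?S"
    by (rule L2_set_triangle_ineq)
  also have "\<dots> = l2 f + l2 g"
    using assms by (subst (1 2) l2_superset[symmetric]) auto
  finally show ?thesis .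
qed

lemma l2_scale: "l2 (\<lambda>x. c * f x) = cmod c * l2 f"
proof (cases "c = 0")
  case True
  then show ?thesis by (simp add: l2_def supp_def)
next
  case False
  then have "supp (\<lambda>x. c * f x) = supp f" by (simp add: supp_def)
  then show ?thesis by (simp add: l2_def norm_mult L2_set_right_distrib)
qed

definition inner_prod :: "('x \<Rightarrow> complex) \<Rightarrow> ('x \<Rightarrow> complex) \<Rightarrow> complex" where
  "inner_prod f g = (\<Sum>x\<in>supp f. f x * cnj (g x))"

lemma ip_superset:
  assumes "finite S" "\<And>x. f x \<noteq> 0 \<Longrightarrow> g x \<noteq> 0 \<Longrightarrow> x \<in> S" "finite (supp f)"
  shows "inner_prod f g = (\<Sum>x\<in>S. f x * cnj (g x))"
proof -
  have "inner_prod f g = (\<Sum>x\<in>supp f \<inter> S. f x * cnj (g x))"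
    unfolding inner_prod_def using assms by (intro sum.mono_neutral_right) (auto simp: supp_def)
  also have "\<dots> = (\<Sum>x\<in>S. f x * cnj (g x))"
    using assms by (intro sum.mono_neutral_left) (auto simp: supp_def)
  finally show ?thesis .
qed

lemma ip_add_left:
  assumes "finite (supp f)" "finite (supp g)"
  shows "inner_prod (\<lambda>x. f x + g x) h = inner_prod f h + inner_prod g h"
proof -
  have "finite (supp (\<lambda>x. f x + g x))"
    by (rule finite_subset[of _ "supp f \<union> supp g"]) (use assms in \<open>auto simp: supp_def\<close>)
  then have "inner_prod (\<lambda>x. f x + g x) h = (\<Sum>x\<in>supp f \<union> supp g. (f x + g x) * cnj (h x))"
    using assms by (intro ip_superset) (auto simp: supp_def)
  moreover have "inner_prod f h = (\<Sum>x\<in>supp f \<union> supp g. f x * cnj (h x))"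
    "inner_prod g h = (\<Sum>x\<in>supp f \<union> supp g. g x * cnj (h x))"
    using assms by (auto intro!: ip_superset simp: supp_def)
  ultimately show ?thesis by (simp add: algebra_simps sum.distrib)
qed

lemma ip_add_right: "inner_prod f (\<lambda>x. g x + h x) = inner_prod f g + inner_prod f h"
  by (simp add: inner_prod_def algebra_simps sum.distrib)

lemma ip_self: "inner_prod f f = of_real ((l2 f)\<^sup>2)"
  by (simp add: inner_prod_def l2_def L2_set_def sum_nonneg complex_mult_cnj cmod_power2)

lemma ip_Cauchy_Schwarz:
  assumes "finite (supp f)" "finite (supp g)"
  shows "cmod (inner_prod f g) \<le> l2 f * l2 g"
proof -
  let ?S = "supp f \<union> supp g"
  have "cmod (inner_prod f g) = cmod (\<Sum>x\<in>?S. f x * cnj (g x))"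
    by (subst ip_superset[of ?S]) (use assms in \<open>auto simp: supp_def\<close>)
  also have "\<dots> \<le> (\<Sum>x\<in>?S. \<bar>cmod (f x)\<bar> * \<bar>cmod (g x)\<bar>)"
    by (rule order_trans[OF norm_sum]) (simp add: norm_mult)
  also have "\<dots> \<le> L2_set (\<lambda>x. cmod (f x)) ?S * L2_set (\<lambda>x. cmod (g x)) ?S"
    by (rule L2_set_mult_ineq)
  also have "\<dots> = l2 f * l2 g"
    using assms by (subst (1 2) l2_superset[symmetric]) auto
  finally show ?thesis .
qed

text \<open>
  Composition with a partial map, extended by zero.  For an injective partial map
  this is a partial isometry whose adjoint is composition with the inverse map.
\<close>

definition pull :: "('x \<Rightarrow> 'x option) \<Rightarrow> ('x \<Rightarrow> complex) \<Rightarrow> 'x \<Rightarrow> complex" where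
  "pull t f x = (case t x of None \<Rightarrow> 0 | Some y \<Rightarrow> f y)"

lemma supp_pull: "supp (pull t f) = {x. \<exists>y\<in>supp f. t x = Some y}"
  by (auto simp: supp_def pull_def split: option.splits)

lemma supp_pull_image:
  assumes "\<And>x y. t x = Some y \<longleftrightarrow> t' y = Some x"
  shows "supp (pull t f) \<subseteq> (the \<circ> t') ` supp f"
  using assms by (force simp: supp_pull)

lemma l2_pull_le:
  assumes inv: "\<And>x y. t x = Some y \<longleftrightarrow> t' y = Some x" and "finite (supp f)"
  shows "l2 (pull t f) \<le> l2 f"
proof -
  let ?S = "supp (pull t f)"
  have "inj_on (the \<circ> t) ?S"
    by (rule inj_on_inverseI[of _ "the \<circ> t'"]) (use inv in \<open>force simp: supp_pull\<close>)
  then have "(\<Sum>x\<in>?S. (cmod (f (the (t x))))\<^sup>2) = (\<Sum>y\<in>(the \<circ> t) ` ?S. (cmod (f y))\<^sup>2)"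
    by (simp add: sum.reindex comp_def)
  moreover have "(\<Sum>x\<in>?S. (cmod (pull t f x))\<^sup>2) = (\<Sum>x\<in>?S. (cmod (f (the (t x))))\<^sup>2)"
    by (rule sum.cong) (auto simp: supp_pull pull_def)
  moreover have "(\<Sum>y\<in>(the \<circ> t) ` ?S. (cmod (f y))\<^sup>2) \<le> (\<Sum>y\<in>supp f. (cmod (f y))\<^sup>2)"
    by (rule sum_mono2) (use assms(2) in \<open>auto simp: supp_pull\<close>)
  ultimately show ?thesis by (simp add: l2_def L2_set_def)
qed

lemma ip_pull:
  assumes inv: "\<And>x y. t x = Some y \<longleftrightarrow> t' y = Some x" and "finite (supp f)"
  shows "inner_prod (pull t f) g = inner_prod f (pull t' g)"
proof -
  let ?S = "supp (pull t f)"
  have inj: "inj_on (the \<circ> t) ?S"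
    by (rule inj_on_inverseI[of _ "the \<circ> t'"]) (use inv in \<open>force simp: supp_pull\<close>)
  have "inner_prod (pull t f) g = (\<Sum>x\<in>?S. (\<lambda>y. f y * cnj (pull t' g y)) ((the \<circ> t) x))"
    unfolding inner_prod_def
  proof (rule sum.cong)
    fix x assume "x \<in> ?S"
    then obtain y where "t x = Some y" "t' y = Some x" using inv by (auto simp: supp_pull)
    then show "pull t f x * cnj (g x) = f ((the \<circ> t) x) * cnj (pull t' g ((the \<circ> t) x))"
      by (simp add: pull_def)
  qed simp
  also have "\<dots> = (\<Sum>y\<in>(the \<circ> t) ` ?S. f y * cnj (pull t' g y))"
    by (subst sum.reindex[OF inj]) (simp add: comp_def)
  also have "\<dots> = inner_prod f (pull t' g)"
  proof (rule ip_superset[symmetric])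
    show "finite ((the \<circ> t) ` ?S)"
      by (rule finite_subset[OF _ assms(2)]) (auto simp: supp_pull)
    show "y \<in> (the \<circ> t) ` ?S" if y: "f y \<noteq> 0" "pull t' g y \<noteq> 0" for y
    proof -
      from y(2) obtain x where "t' y = Some x" by (auto simp: pull_def split: option.splits)
      then have "t x = Some y" using inv by simp
      then show ?thesis using y(1) by (intro image_eqI[of _ _ x]) (auto simp: supp_def pull_def)
    qed
  qed (rule assms(2))
  finally show ?thesis .
qed

text \<open>
  The adjoint letter must be the inverse partial map.  The set \<open>B\<close> indexes the
  orthonormal basis; vectors are supported on \<open>B\<close>, because at a point where no letter is defined the
  range projections could not sum to the unit.
\<close>

locale partial_injections =
  fixes \<tau> :: "'g star_letter \<Rightarrow> 'x \<Rightarrow> 'x option" and B :: "'x set"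
  assumes inverse: "\<tau> (Gen g) x = Some y \<longleftrightarrow> \<tau> (Adj g) y = Some x"
    and dom: "\<tau> l x = Some y \<Longrightarrow> x \<in> B"
begin

lemma inverse_letter: "\<tau> l x = Some y \<longleftrightarrow> \<tau> (adj_letter l) y = Some x"
  by (cases l) (simp_all add: inverse)

text \<open>
  Operators pull functions back along the partial maps, so the leftmost letter of a monomial is
  the first one to be followed.
\<close>

fun follow :: "'g star_letter list \<Rightarrow> 'x \<Rightarrow> 'x option" where
  "follow [] x = Some x"
| "follow (l # ls) x = Option.bind (\<tau> l x) (follow ls)"

lemma follow_append: "follow (u @ v) x = Option.bind (follow u x) (follow v)"
  by (induction u arbitrary: x) (auto split: Option.bind_split)

lemma follow_inverse:
  "follow ls x = Some y \<longleftrightarrow> follow (rev (map adj_letter ls)) y = Some x"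
proof (induction ls arbitrary: x)
  case (Cons l ls)
  have "\<tau> l x = Some z \<longleftrightarrow> \<tau> (adj_letter l) z = Some x" for z
    by (rule inverse_letter)
  then show ?case
    using Cons.IH by (auto simp: follow_append bind_eq_Some_conv)
qed auto

definition monom_op :: "'g star_monom \<Rightarrow> ('x \<Rightarrow> complex) \<Rightarrow> 'x \<Rightarrow> complex" where
  "monom_op w = pull (follow (letters w))"

definition rep :: "'g star_poly \<Rightarrow> ('x \<Rightarrow> complex) \<Rightarrow> 'x \<Rightarrow> complex" where
  "rep a f x = (\<Sum>w\<in>Poly_Mapping.keys a. Poly_Mapping.lookup a w * monom_op w f x)"

lemma rep_superset:
  assumes "finite S" "Poly_Mapping.keys a \<subseteq> S"
  shows "rep a f x = (\<Sum>w\<in>S. Poly_Mapping.lookup a w * monom_op w f x)"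
  unfolding rep_def using assms by (intro sum.mono_neutral_left) (auto simp: in_keys_iff)

lemma rep_add: "rep (a + b) f x = rep a f x + rep b f x"
proof -
  let ?S = "Poly_Mapping.keys a \<union> Poly_Mapping.keys b"
  show ?thesis
    using rep_superset[of ?S a f x] rep_superset[of ?S b f x] rep_superset[of ?S "a + b" f x]
      Poly_Mapping.keys_add[of a b]
    by (simp add: lookup_add sum.distrib algebra_simps)
qed

lemma rep_0 [simp]: "rep 0 f x = 0"
  by (simp add: rep_def)

lemma rep_minus: "rep (a - b) f x = rep a f x - rep b f x"
  using rep_add[of "a - b" b f x] by simp

lemma rep_sum: "rep (sum a S) f x = (\<Sum>i\<in>S. rep (a i) f x)"
  by (induction S rule: infinite_finite_induct) (simp_all add: rep_add)

lemma rep_single: "rep (Poly_Mapping.single w c) f x = c * monom_op w f x"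
  by (cases "c = 0") (simp_all add: rep_def)

lemma monom_op_plus: "monom_op (u + v) f = monom_op u (monom_op v f)"
  by (auto simp: monom_op_def pull_def plus_star_monom_def follow_append fun_eq_iff
      split: option.splits Option.bind_splits)

lemma rep_linear: "rep a (\<lambda>x. c * f x + d * g x) x = c * rep a f x + d * rep a g x"
proof -
  have "monom_op w (\<lambda>x. c * f x + d * g x) x = c * monom_op w f x + d * monom_op w g x" for w
    by (simp add: monom_op_def pull_def split: option.splits)
  then show ?thesis by (simp add: rep_def sum_distrib_left sum.distrib algebra_simps)
qed

lemma rep_mult: "rep (a * b) f = rep a (rep b f)"
proof (induction a rule: poly_mapping_induct_plus)
  case (plus a u c)
  have lin: "monom_op u (\<lambda>x. g x + h x) y = monom_op u g y + monom_op u h y" for g h y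
    by (simp add: monom_op_def pull_def split: option.splits)
  have scal: "monom_op u (\<lambda>x. d * g x) y = d * monom_op u g y" for g y d
    by (simp add: monom_op_def pull_def split: option.splits)
  have "rep (Poly_Mapping.single u c * b) f x = c * monom_op u (rep b f) x" for x
  proof (induction b rule: poly_mapping_induct_plus)
    case zero
    show ?case by (simp add: monom_op_def pull_def split: option.splits)
  next
    case (plus b v d)
    have "rep (b + Poly_Mapping.single v d) f = (\<lambda>x. rep b f x + d * monom_op v f x)"
      by (simp add: fun_eq_iff rep_add rep_single)
    then show ?case
      using plus by (simp add: algebra_simps rep_add mult_single rep_single monom_op_plus lin scal)
  qed
  with plus show ?case by (simp add: fun_eq_iff algebra_simps rep_add rep_single)
qed (simp add: fun_eq_iff)

lemma rep_1 [simp]: "rep 1 f x = f x"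
  using rep_single[of 0 1 f x] by (simp add: monom_op_def pull_def) (simp add: zero_star_monom_def)

lemma rep_scale: "rep (scale_poly c a) f x = c * rep a f x"
  unfolding scale_poly_def rep_mult
  by (simp add: rep_single) (simp add: monom_op_def pull_def zero_star_monom_def)

definition vectors :: "('x \<Rightarrow> complex) set" where
  "vectors = {f. finite (supp f) \<and> supp f \<subseteq> B}"

lemma zero_vectors: "(\<lambda>_. 0) \<in> vectors"
  by (simp add: vectors_def supp_def)

lemma lin_vectors: "f \<in> vectors \<Longrightarrow> g \<in> vectors \<Longrightarrow> (\<lambda>x. c * f x + d * g x) \<in> vectors"
proof -
  assume "f \<in> vectors" "g \<in> vectors"
  moreover have "supp (\<lambda>x. c * f x + d * g x) \<subseteq> supp f \<union> supp g"
    by (auto simp: supp_def)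
  ultimately show ?thesis
    unfolding vectors_def by (blast intro: finite_subset)
qed

lemma add_vectors: "f \<in> vectors \<Longrightarrow> g \<in> vectors \<Longrightarrow> (\<lambda>x. f x + g x) \<in> vectors"
  using lin_vectors[of f g 1 1] by simp

lemma scale_vectors: "f \<in> vectors \<Longrightarrow> (\<lambda>x. c * f x) \<in> vectors"
  using lin_vectors[of f f c 0] by simp

lemma monom_op_vectors:
  assumes "f \<in> vectors"
  shows "monom_op w f \<in> vectors"
proof -
  have "supp (monom_op w f) \<subseteq> B"
    using assms dom unfolding monom_op_def supp_pull vectors_def
    by (cases "letters w") (auto simp: bind_eq_Some_conv)
  moreover have "finite (supp (monom_op w f))"
    unfolding monom_op_def
    using assms by (intro finite_subset[OF supp_pull_image[OF follow_inverse]]) (simp add: vectors_def)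
  ultimately show ?thesis by (simp add: vectors_def)
qed

lemma rep_plus_single:
  "rep (a + Poly_Mapping.single w c) f = (\<lambda>x. rep a f x + c * monom_op w f x)"
  by (simp add: fun_eq_iff rep_add rep_single)

lemma rep_vectors: "f \<in> vectors \<Longrightarrow> rep a f \<in> vectors"
proof (induction a rule: poly_mapping_induct_plus)
  case zero
  then show ?case using zero_vectors by (simp add: rep_def)
next
  case (plus a w c)
  then show ?case unfolding rep_plus_single by (intro add_vectors scale_vectors monom_op_vectors)
qed

lemma rep_adjoint:
  assumes f: "f \<in> vectors" and g: "g \<in> vectors"
  shows "inner_prod (rep a f) g = inner_prod f (rep (adj_poly a) g)"
proof (induction a rule: poly_mapping_induct_plus)
  case zero
  show ?case by (simp add: inner_prod_def)
next
  case (plus a w c)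
  have fin: "finite (supp h)" if "h \<in> vectors" for h using that by (simp add: vectors_def)
  have "inner_prod (\<lambda>x. c * h x) g = c * inner_prod h g" for h
  proof (cases "c = 0")
    case False
    then have "supp (\<lambda>x. c * h x) = supp h" by (simp add: supp_def)
    then show ?thesis by (simp add: inner_prod_def sum_distrib_left mult.assoc)
  qed (simp add: inner_prod_def supp_def)
  moreover have "inner_prod (monom_op w f) g = inner_prod f (monom_op (adj_monom w) g)"
    unfolding monom_op_def adj_monom_def star_monom.sel
    using f by (intro ip_pull follow_inverse) (simp add: vectors_def)
  moreover have "inner_prod f (\<lambda>x. cnj c * h x) = c * inner_prod f h" for h
    by (simp add: inner_prod_def sum_distrib_left mult.left_commute)
  moreover have "inner_prod (rep (a + Poly_Mapping.single w c) f) g = inner_prod (rep a f) g + inner_prod (\<lambda>x. c * monom_op w f x) g"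
    unfolding rep_plus_single
    by (intro ip_add_left fin rep_vectors scale_vectors monom_op_vectors f)
  ultimately show ?case
    using plus by (simp add: adj_poly_add adj_poly_single rep_plus_single ip_add_right)
qed

lemma l2_rep_le:
  assumes "f \<in> vectors"
  shows "l2 (rep a f) \<le> (\<Sum>w\<in>Poly_Mapping.keys a. cmod (Poly_Mapping.lookup a w)) * l2 f"
proof -
  have "l2 (\<lambda>x. \<Sum>w\<in>S. Poly_Mapping.lookup a w * monom_op w f x)
      \<le> (\<Sum>w\<in>S. cmod (Poly_Mapping.lookup a w)) * l2 f \<and>
      (\<lambda>x. \<Sum>w\<in>S. Poly_Mapping.lookup a w * monom_op w f x) \<in> vectors" if "finite S" for S
    using that
  proof (induction S)
    case empty
    show ?case by (simp add: zero_vectors l2_nonneg) (simp add: l2_def supp_def)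
  next
    case (insert w S)
    let ?h = "\<lambda>x. Poly_Mapping.lookup a w * monom_op w f x"
    have h: "?h \<in> vectors" by (intro scale_vectors monom_op_vectors assms)
    have "l2 (monom_op w f) \<le> l2 f"
      unfolding monom_op_def using assms
      by (intro l2_pull_le[OF follow_inverse]) (simp add: vectors_def)
    then have "l2 ?h \<le> cmod (Poly_Mapping.lookup a w) * l2 f"
      by (simp add: l2_scale mult_left_mono)
    let ?g = "\<lambda>x. \<Sum>w\<in>S. Poly_Mapping.lookup a w * monom_op w f x"
    have g: "l2 ?g \<le> (\<Sum>w\<in>S. cmod (Poly_Mapping.lookup a w)) * l2 f" "?g \<in> vectors"
      using insert.IH by simp_all
    have "l2 (\<lambda>x. ?h x + ?g x) \<le> l2 ?h + l2 ?g"
      by (rule l2_add) (use h g(2) in \<open>simp_all add: vectors_def\<close>)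
    also have "\<dots> \<le> (\<Sum>w\<in>insert w S. cmod (Poly_Mapping.lookup a w)) * l2 f"
      using \<open>l2 ?h \<le> _\<close> g(1) insert.hyps by (simp add: distrib_right)
    finally show ?case
      using add_vectors[OF h g(2)] insert.hyps by simp
  qed
  then show ?thesis unfolding rep_def by auto
qed

definition op_norm :: "'g star_poly \<Rightarrow> real" where
  "op_norm a = (SUP f\<in>{f\<in>vectors. l2 f \<le> 1}. l2 (rep a f))"

lemma op_norm_bdd: "bdd_above ((\<lambda>f. l2 (rep a f)) ` {f\<in>vectors. l2 f \<le> 1})"
proof (rule bdd_aboveI2)
  fix f assume "f \<in> {f\<in>vectors. l2 f \<le> 1}"
  then show "l2 (rep a f) \<le> (\<Sum>w\<in>Poly_Mapping.keys a. cmod (Poly_Mapping.lookup a w))"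
    by (intro order_trans[OF l2_rep_le] mult_left_le) (auto intro: sum_nonneg)
qed

lemma op_norm_least: "(\<And>f. f \<in> vectors \<Longrightarrow> l2 f \<le> 1 \<Longrightarrow> l2 (rep a f) \<le> c) \<Longrightarrow> op_norm a \<le> c"
  unfolding op_norm_def using zero_vectors by (intro cSUP_least) (auto simp: l2_def supp_def)

lemma l2_rep: "f \<in> vectors \<Longrightarrow> l2 f \<le> 1 \<Longrightarrow> l2 (rep a f) \<le> op_norm a"
  unfolding op_norm_def by (rule cSUP_upper[OF _ op_norm_bdd]) simp

lemma op_norm_nonneg: "0 \<le> op_norm a"
  by (rule order_trans[OF l2_nonneg l2_rep[OF zero_vectors]]) (simp add: l2_def supp_def)

lemma l2_rep_le_op_norm:
  assumes "f \<in> vectors"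
  shows "l2 (rep a f) \<le> op_norm a * l2 f"
proof (cases "l2 f = 0")
  case True
  then show ?thesis using l2_rep_le[OF assms, of a] by simp
next
  case False
  let ?c = "complex_of_real (1 / l2 f)"
  have c: "cmod ?c = 1 / l2 f"
    using l2_nonneg[of f] by (simp only: norm_of_real) simp
  have "l2 (rep a (\<lambda>x. ?c * f x)) \<le> op_norm a"
    using False by (intro l2_rep scale_vectors assms) (simp only: l2_scale c, simp)
  moreover have "rep a (\<lambda>x. ?c * f x) = (\<lambda>x. ?c * rep a f x)"
    using rep_linear[of a ?c f 0 f] by (simp add: fun_eq_iff)
  ultimately have "1 / l2 f * l2 (rep a f) \<le> op_norm a"
    by (simp only: l2_scale c)
  then show ?thesis
    using False l2_nonneg[of f] by (simp add: field_simps)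
qed

lemma cstar_seminorm_op_norm: "cstar_seminorm op_norm"
proof (rule cstar_seminormI)
  show "op_norm (a + b) \<le> op_norm a + op_norm b" for a b
  proof (rule op_norm_least)
    fix f assume f: "f \<in> vectors" "l2 f \<le> 1"
    have "rep (a + b) f = (\<lambda>x. rep a f x + rep b f x)" by (simp add: fun_eq_iff rep_add)
    then have "l2 (rep (a + b) f) \<le> l2 (rep a f) + l2 (rep b f)"
      using rep_vectors[OF f(1)] by (simp add: vectors_def l2_add)
    also have "\<dots> \<le> op_norm a + op_norm b" by (intro add_mono l2_rep f)
    finally show "l2 (rep (a + b) f) \<le> op_norm a + op_norm b" .
  qed
  show "op_norm (scale_poly c a) \<le> cmod c * op_norm a" for c a
  proof (rule op_norm_least)
    fix f assume f: "f \<in> vectors" "l2 f \<le> 1"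
    have "rep (scale_poly c a) f = (\<lambda>x. c * rep a f x)" by (simp add: fun_eq_iff rep_scale)
    then show "l2 (rep (scale_poly c a) f) \<le> cmod c * op_norm a"
      using l2_rep[OF f, of a] by (simp add: l2_scale mult_left_mono)
  qed
  show "op_norm (a * b) \<le> op_norm a * op_norm b" for a b
  proof (rule op_norm_least)
    fix f assume f: "f \<in> vectors" "l2 f \<le> 1"
    have "l2 (rep (a * b) f) \<le> op_norm a * l2 (rep b f)"
      unfolding rep_mult by (intro l2_rep_le_op_norm rep_vectors f)
    also have "\<dots> \<le> op_norm a * op_norm b"
      by (intro mult_left_mono l2_rep f op_norm_nonneg)
    finally show "l2 (rep (a * b) f) \<le> op_norm a * op_norm b" .
  qed
  show "(op_norm a)\<^sup>2 \<le> op_norm (adj_poly a * a)" for a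
  proof -
    have "op_norm a \<le> sqrt (op_norm (adj_poly a * a))"
    proof (rule op_norm_least)
      fix f assume f: "f \<in> vectors" "l2 f \<le> 1"
      have "complex_of_real ((l2 (rep a f))\<^sup>2) = inner_prod f (rep (adj_poly a * a) f)"
        using rep_adjoint[OF f(1) rep_vectors[OF f(1)], of a a] by (simp add: ip_self rep_mult)
      then have "(l2 (rep a f))\<^sup>2 = cmod (inner_prod f (rep (adj_poly a * a) f))"
        by (metis norm_of_real abs_of_nonneg zero_le_power2)
      also have "\<dots> \<le> l2 f * l2 (rep (adj_poly a * a) f)"
        using f(1) rep_vectors[OF f(1)] by (intro ip_Cauchy_Schwarz) (auto simp: vectors_def)
      also have "\<dots> \<le> 1 * op_norm (adj_poly a * a)"
        by (intro mult_mono l2_rep f) (simp_all add: l2_nonneg)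
      finally show "l2 (rep a f) \<le> sqrt (op_norm (adj_poly a * a))"
        by (simp add: real_le_rsqrt)
    qed
    then show ?thesis
      using op_norm_nonneg by (metis power_mono real_sqrt_pow2)
  qed
qed (rule op_norm_nonneg)

lemma op_norm_zero:
  assumes "\<And>f x. f \<in> vectors \<Longrightarrow> rep a f x = 0"
  shows "op_norm a = 0"
proof (rule antisym[OF op_norm_least op_norm_nonneg])
  fix f assume "f \<in> vectors"
  then have "rep a f = (\<lambda>_. 0)" using assms by blast
  then show "l2 (rep a f) \<le> 0" by (simp add: l2_def supp_def)
qed

definition basis_vector :: "'x \<Rightarrow> 'x \<Rightarrow> complex" where
  "basis_vector x y = (if y = x then 1 else 0)"

lemma basis_vector_vectors: "x \<in> B \<Longrightarrow> basis_vector x \<in> vectors"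
  by (simp add: vectors_def supp_def basis_vector_def)

lemma l2_basis_vector: "l2 (basis_vector x) = 1"
  by (simp add: l2_def supp_def basis_vector_def)

lemma rep_gen: "rep (gen i) f x = pull (\<tau> (Gen i)) f x"
  by (simp add: gen_def rep_single monom_op_def pull_def split: option.splits)

lemma rep_adj_gen: "rep (adj_poly (gen i)) f x = pull (\<tau> (Adj i)) f x"
  by (simp add: adj_poly_gen rep_single monom_op_def pull_def split: option.splits)

end

section \<open>The path representation and the forbidden words\<close>

context ck_matrix
begin

text \<open>
  Functions are pulled back, so \<open>Gen i\<close> is the map that removes \<open>i\<close>; on basis vectors
  it becomes the operator that prepends \<open>i\<close>.
\<close>

fun path_shift :: "'i star_letter \<Rightarrow> (nat \<Rightarrow> 'i) \<Rightarrow> (nat \<Rightarrow> 'i) option" where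
  "path_shift (Gen i) x = (if x \<in> infinite_paths I A \<and> x 0 = i then Some (x \<circ> Suc) else None)"
| "path_shift (Adj i) x =
    (if x \<in> infinite_paths I A \<and> i \<in> I \<and> A i (x 0) = 1 then Some (case_nat i x) else None)"

lemma tail_paths: "x \<in> infinite_paths I A \<Longrightarrow> x \<circ> Suc \<in> infinite_paths I A"
  by (simp add: infinite_paths_def)

lemma case_nat_tail: "case_nat (x 0) (x \<circ> Suc) = x"
  by (auto split: nat.split)

sublocale ck: partial_injections path_shift "infinite_paths I A"
proof
  fix i x y
  show "path_shift (Gen i) x = Some y \<longleftrightarrow> path_shift (Adj i) y = Some x"
  proof
    assume "path_shift (Gen i) x = Some y"
    then have "x \<in> infinite_paths I A" "x 0 = i" "y = x \<circ> Suc" by (auto split: if_splits)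
    then show "path_shift (Adj i) y = Some x"
      using tail_paths case_nat_tail[of x] by (auto simp: infinite_paths_def)
  next
    assume "path_shift (Adj i) y = Some x"
    then have "y \<in> infinite_paths I A" "i \<in> I" "A i (y 0) = 1" "x = case_nat i y" by (auto split: if_splits)
    then show "path_shift (Gen i) x = Some y"
      by (simp add: case_nat_paths comp_def)
  qed
next
  fix l x y assume "path_shift l x = Some y"
  then show "x \<in> infinite_paths I A" by (cases l) (auto split: if_splits)
qed

lemma outside: "f \<in> ck.vectors \<Longrightarrow> x \<notin> infinite_paths I A \<Longrightarrow> f x = 0"
  by (auto simp: ck.vectors_def supp_def)

lemma rep_range:
  assumes "f \<in> ck.vectors"
  shows "ck.rep (gen i * adj_poly (gen i)) f x = (if x 0 = i then f x else 0)"
proof (cases "x \<in> infinite_paths I A")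
  case True
  then have "x 0 \<in> I" "A (x 0) (x 1) = 1" by (auto simp: infinite_paths_def)
  then show ?thesis
    using True tail_paths[OF True] case_nat_tail[of x]
    by (auto simp: ck.rep_mult ck.rep_gen ck.rep_adj_gen pull_def)
next
  case False
  then show ?thesis
    using outside[OF assms] by (simp add: ck.rep_mult ck.rep_gen pull_def)
qed

lemma rep_source:
  assumes "f \<in> ck.vectors" "i \<in> I"
  shows "ck.rep (adj_poly (gen i) * gen i) f x = of_nat (A i (x 0)) * f x"
proof (cases "x \<in> infinite_paths I A \<and> A i (x 0) = 1")
  case True
  then show ?thesis
    using assms(2) by (simp add: ck.rep_mult ck.rep_gen ck.rep_adj_gen pull_def case_nat_paths comp_def)
next
  case False
  then have "of_nat (A i (x 0)) * f x = 0"
    using outside[OF assms(1), of x] zero_one[of i "x 0"] by auto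
  then show ?thesis
    using False by (auto simp add: ck.rep_mult ck.rep_gen ck.rep_adj_gen pull_def)
qed

lemma op_norm_admissible: "ck.op_norm \<in> admissible_norms (ck_relations I A)"
proof -
  have "ck.rep r f x = 0" if r: "r \<in> ck_relations I A" and f: "f \<in> ck.vectors" for r f x
  proof -
    have at_0: "(\<Sum>j\<in>I. if x 0 = j then c j else 0) * f x = c (x 0) * f x" for c :: "'i \<Rightarrow> complex"
      using outside[OF f, of x] finite_I by (cases "x \<in> infinite_paths I A") (auto simp: infinite_paths_def)
    have nat: "ck.rep (of_nat n * a) f x = of_nat n * ck.rep a f x" for n a
      using ck.rep_scale[of "of_nat n" a] by (simp add: scale_poly_of_nat)
    consider i where "r = gen i * adj_poly (gen i) * gen i - gen i"
      | "r = (\<Sum>j\<in>I. gen j * adj_poly (gen j)) - 1"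
      | i where "i \<in> I" "r = adj_poly (gen i) * gen i - (\<Sum>j\<in>I. of_nat (A i j) * (gen j * adj_poly (gen j)))"
      | i where "i \<notin> I" "r = gen i"
      using r by (auto simp: ck_relations_def)
    then show ?thesis
    proof cases
      case 1
      then show ?thesis
        using rep_range[OF ck.rep_vectors[OF f], of i "gen i" x]
        by (simp add: ck.rep_minus ck.rep_mult[of "_ * _" "gen i"]) (simp add: ck.rep_gen pull_def)
    next
      case 2
      then show ?thesis
        using at_0[of "\<lambda>_. 1"]
        by (simp add: ck.rep_minus ck.rep_sum rep_range[OF f] if_distrib sum_distrib_right if_distribR cong: if_cong)
    next
      case 3
      then show ?thesis
        using at_0[of "\<lambda>j. of_nat (A i j)"]
        by (simp add: ck.rep_minus ck.rep_sum rep_range[OF f] rep_source[OF f] nat if_distrib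
            sum_distrib_right if_distribR cong: if_cong)
    next
      case 4
      then show ?thesis by (auto simp: ck.rep_gen pull_def infinite_paths_def)
    qed
  qed
  then show ?thesis
    by (simp add: admissible_norms_def ck.cstar_seminorm_op_norm ck.op_norm_zero)
qed

lemma rep_step:
  assumes "x \<in> infinite_paths I A" "dyck_step I A s x = Some y"
  shows "ck.rep (dyck_poly s) (ck.basis_vector x) = ck.basis_vector y"
proof
  fix z
  show "ck.rep (dyck_poly s) (ck.basis_vector x) z = ck.basis_vector y z"
  proof (cases s)
    case (Beta i)
    then have y: "y = case_nat i x" "i \<in> I" "A i (x 0) = 1" using assms(2) by (auto split: if_splits)
    then have "y \<in> infinite_paths I A" using assms(1) by (simp add: case_nat_paths)
    moreover have "z \<in> infinite_paths I A \<and> z 0 = i \<and> z \<circ> Suc = x \<longleftrightarrow> z = y"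
      using calculation y(1) case_nat_tail[of z] by (auto simp: comp_def)
    ultimately show ?thesis
      using Beta by (auto simp: ck.rep_gen pull_def ck.basis_vector_def)
  next
    case (Alpha i)
    then have y: "x 0 = i" "y = x \<circ> Suc" using assms(2) by (auto split: if_splits)
    have "z \<in> infinite_paths I A \<and> i \<in> I \<and> A i (z 0) = 1 \<and> case_nat i z = x \<longleftrightarrow> z = y"
    proof
      assume "z = y"
      then show "z \<in> infinite_paths I A \<and> i \<in> I \<and> A i (z 0) = 1 \<and> case_nat i z = x"
        using y assms(1) tail_paths case_nat_tail[of x] by (auto simp: infinite_paths_def)
    qed (auto simp: y comp_def)
    then show ?thesis
      using Alpha by (auto simp: ck.rep_adj_gen pull_def ck.basis_vector_def)
  qed
qed

lemma rep_act:
  assumes "x \<in> infinite_paths I A" "dyck_act I A w x = Some y"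
  shows "ck.rep (word_poly w) (ck.basis_vector x) = ck.basis_vector y"
  using assms(2)
proof (induction w arbitrary: y)
  case Nil
  then show ?case by (simp add: fun_eq_iff)
next
  case (Cons s w)
  then obtain z where z: "dyck_act I A w x = Some z" "dyck_step I A s z = Some y"
    by (auto simp: bind_eq_Some_conv)
  then show ?case
    using Cons.IH rep_step[of z s y] act_paths[OF assms(1)] by (simp add: ck.rep_mult)
qed

sublocale contractive_relations "ck_relations I A"
proof
  fix p and i :: 'i assume p: "p \<in> admissible_norms (ck_relations I A)"
  then interpret ck_norm I A p
    by unfold_locales (simp_all add: admissible_norms_def)
  show "p (gen i) \<le> 1" by (rule gen_le_1)
qed

lemma ck_product:
  "foldr (ck_mult I A) (map (dyck_op I A) w) (ck_one I A) = univ_of (ck_relations I A) (word_poly w)"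
proof (induction w)
  case Nil
  show ?case by (simp add: ck_one_def)
next
  case (Cons s w)
  have "dyck_op I A s = univ_of (ck_relations I A) (dyck_poly s)"
    by (cases s) (simp_all add: ck_adj_def ck_gen_def univ_adj_of)
  then show ?case by (simp add: Cons.IH) (simp add: ck_mult_def univ_mult_of)
qed

text \<open>
  One direction is \<open>word_poly_zero\<close>, applied to the universal norm.  For the other, a
  word that maps a path to a path maps a basis vector to a basis vector, so its operator norm is at
  least 1, and the universal norm dominates the operator norm.
\<close>

lemma dyck_forbidden_iff:
  "w \<in> dyck_forbidden I A \<longleftrightarrow>
    w \<in> lists (dyck_alphabet I) \<and> w \<noteq> [] \<and> (\<forall>x\<in>infinite_paths I A. dyck_act I A w x = None)"
proof -
  interpret N: ck_norm I A "univ_norm (ck_relations I A)"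
    by unfold_locales (rule univ_norm_admissible)
  have "univ_norm (ck_relations I A) (word_poly w) = 0 \<longleftrightarrow> (\<forall>x\<in>infinite_paths I A. dyck_act I A w x = None)"
    if "w \<in> lists (dyck_alphabet I)"
  proof
    assume zero: "univ_norm (ck_relations I A) (word_poly w) = 0"
    show "\<forall>x\<in>infinite_paths I A. dyck_act I A w x = None"
    proof (intro ballI, rule ccontr)
      fix x assume x: "x \<in> infinite_paths I A" and "dyck_act I A w x \<noteq> None"
      then obtain y where "dyck_act I A w x = Some y" by auto
      then have "l2 (ck.rep (word_poly w) (ck.basis_vector x)) = 1"
        using rep_act x by (simp add: ck.l2_basis_vector)
      then have "1 \<le> ck.op_norm (word_poly w)"
        using ck.l2_rep[OF ck.basis_vector_vectors[OF x], of "word_poly w"] by (simp add: ck.l2_basis_vector)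
      also have "\<dots> \<le> 0"
        using le_univ_norm[OF op_norm_admissible, of "word_poly w"] zero by simp
      finally show False by simp
    qed
  next
    assume "\<forall>x\<in>infinite_paths I A. dyck_act I A w x = None"
    then show "univ_norm (ck_relations I A) (word_poly w) = 0"
      using N.word_poly_zero[OF that] by (simp add: N.eqv_zero_iff)
  qed
  then show ?thesis
    unfolding dyck_forbidden_def ck_product ck_zero_def univ_of_eq_iff by auto
qed

end

section \<open>Legal words, compactness and heights\<close>

lemma act_append: "dyck_act I A (u @ v) x = Option.bind (dyck_act I A v x) (dyck_act I A u)"
  by (induction u) (auto split: Option.bind_split)

lemma block_Cons: "i \<le> j \<Longrightarrow> block x i j = x i # block x (i + 1) j"
  by (simp add: block_def upto_rec1)

lemma block_append: "i \<le> j + 1 \<Longrightarrow> j \<le> k \<Longrightarrow> block x i k = block x i j @ block x (j + 1) k"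
proof -
  assume "i \<le> j + 1" "j \<le> k"
  then consider "i = j + 1" | "i \<le> j" by linarith
  then show ?thesis
  proof cases
    case 2
    then show ?thesis using \<open>j \<le> k\<close> by (simp add: block_def upto_split2[of i j k])
  qed (simp add: block_def)
qed

lemma block_factor:
  assumes "a \<le> i" "i \<le> j" "j \<le> b"
  shows "block x a b = block x a (i - 1) @ block x i j @ block x (j + 1) b"
  using assms block_append[of a "i - 1" b x] block_append[of i j b x] by simp

lemma block_cong: "(\<And>k. i \<le> k \<Longrightarrow> k \<le> j \<Longrightarrow> x k = y k) \<Longrightarrow> block x i j = block y i j"
  by (simp add: block_def)

text \<open>
  A diagonal argument.  By the pigeonhole principle there are infinite sets of indices \<open>M 0 \<supseteq> M 1 \<supseteq> \<dots>\<close>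
  such that all sequences with index in \<open>M n\<close> agree on \<open>{- n..n}\<close>; the limit takes these common
  values.
\<close>

lemma full_shift_compact:
  fixes x :: "nat \<Rightarrow> int \<Rightarrow> 'a"
  assumes "finite S" "\<And>m. range (x m) \<subseteq> S"
  shows "\<exists>z. \<forall>n. \<exists>m\<ge>n. \<forall>k. \<bar>k\<bar> \<le> int n \<longrightarrow> z k = x m k"
proof -
  define agree where "agree n M \<longleftrightarrow> (\<forall>m\<in>M. \<forall>m'\<in>M. \<forall>k. \<bar>k\<bar> \<le> int n \<longrightarrow> x m k = x m' k)" for n M
  have refine: "\<exists>M'\<subseteq>M. infinite M' \<and> agree n M'" if "infinite M" for n M
  proof -
    let ?b = "\<lambda>m. block (x m) (- int n) (int n)"
    have "?b ` M \<subseteq> {xs. set xs \<subseteq> S \<and> length xs = length [- int n..int n]}"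
    proof -
      have "x m k \<in> S" for m k
        using assms(2)[of m] by blast
      then show ?thesis by (auto simp: block_def)
    qed
    then have "finite (?b ` M)"
      using finite_lists_length_eq[OF assms(1)] finite_subset by blast
    from pigeonhole_infinite[OF that this] obtain m0 where "infinite {m \<in> M. ?b m = ?b m0}"
      by blast
    moreover have "agree n {m \<in> M. ?b m = ?b m0}"
    proof -
      have same: "x m k = x m0 k" if "?b m = ?b m0" "\<bar>k\<bar> \<le> int n" for m k
      proof -
        have "k \<in> set [- int n..int n]" using that(2) by auto
        then show ?thesis using that(1) unfolding block_def map_eq_conv by blast
      qed
      show ?thesis
        unfolding agree_def
      proof (intro ballI allI impI)
        fix m m' k
        assume "m \<in> {m \<in> M. ?b m = ?b m0}" "m' \<in> {m \<in> M. ?b m = ?b m0}" "\<bar>k\<bar> \<le> int n"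
        then show "x m k = x m' k"
          using same[of m k] same[of m' k] by (simp only: mem_Collect_eq)
      qed
    qed
    ultimately show ?thesis
      by (intro exI[of _ "{m \<in> M. ?b m = ?b m0}"] conjI) auto
  qed
  have "\<exists>M. \<forall>n. (infinite (M n) \<and> agree n (M n)) \<and> M (Suc n) \<subseteq> M n"
  proof (rule dependent_nat_choice)
    show "\<exists>M. infinite M \<and> agree 0 M"
      using refine[of UNIV 0] by auto
    show "\<exists>M'. (infinite M' \<and> agree (Suc n) M') \<and> M' \<subseteq> M" if "infinite M \<and> agree n M" for M n
      using refine[of M "Suc n"] that by auto
  qed
  then obtain M where M: "\<And>n. infinite (M n)" "\<And>n. agree n (M n)" "\<And>n. M (Suc n) \<subseteq> M n"
    by blast
  have mono: "M n \<subseteq> M n'" if "n' \<le> n" for n n'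
    by (rule lift_Suc_antimono_le[of M, OF M(3) that])
  define z where "z k = x (SOME m. m \<in> M (nat \<bar>k\<bar>)) k" for k
  have "\<exists>m\<ge>n. \<forall>k. \<bar>k\<bar> \<le> int n \<longrightarrow> z k = x m k" for n
  proof -
    obtain m where m: "m \<ge> n" "m \<in> M n"
      using M(1)[of n] by (meson infinite_nat_iff_unbounded_le)
    have "z k = x m k" if "\<bar>k\<bar> \<le> int n" for k
    proof -
      have "nat \<bar>k\<bar> \<le> n" using that by simp
      then have "m \<in> M (nat \<bar>k\<bar>)" using mono m(2) by blast
      moreover from this have "(SOME m. m \<in> M (nat \<bar>k\<bar>)) \<in> M (nat \<bar>k\<bar>)"
        by (rule someI)
      moreover have "\<bar>k\<bar> \<le> int (nat \<bar>k\<bar>)" by simp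
      ultimately show ?thesis
        using M(2)[of "nat \<bar>k\<bar>"] unfolding z_def agree_def by blast
    qed
    with m show ?thesis by blast
  qed
  then show ?thesis by blast
qed

definition legal :: "'i set \<Rightarrow> ('i \<Rightarrow> 'i \<Rightarrow> nat) \<Rightarrow> 'i dyck_symbol list \<Rightarrow> bool" where
  "legal I A w \<longleftrightarrow> (\<exists>x\<in>infinite_paths I A. dyck_act I A w x \<noteq> None)"

lemma legal_factor:
  assumes "legal I A (u @ v @ w)"
  shows "legal I A v"
proof -
  obtain x y where "x \<in> infinite_paths I A" "dyck_act I A (u @ v @ w) x = Some y"
    using assms by (auto simp: legal_def)
  moreover then obtain z where "dyck_act I A w x = Some z" "dyck_act I A v z \<noteq> None"
    by (auto simp: act_append bind_eq_Some_conv)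
  ultimately show ?thesis
    using act_paths unfolding legal_def by blast
qed

lemma (in ck_matrix) markov_dyck_iff:
  "x \<in> markov_dyck I A \<longleftrightarrow>
    range x \<subseteq> dyck_alphabet I \<and> (\<forall>i j. i \<le> j \<longrightarrow> legal I A (block x i j))"
proof -
  have "block x i j \<notin> dyck_forbidden I A \<longleftrightarrow> legal I A (block x i j)"
    if "range x \<subseteq> dyck_alphabet I" "i \<le> j" for i j
  proof -
    have "block x i j \<in> lists (dyck_alphabet I)" "block x i j \<noteq> []"
      using that by (auto simp: block_def subset_iff)
    then show ?thesis by (auto simp: dyck_forbidden_iff legal_def)
  qed
  then show ?thesis by (auto simp: markov_dyck_def subshift_def)
qed

lemma height_Suc: "height x (m + 1) = height x m + chi_minus (x m) - chi_plus (x m)"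
proof (cases "0 \<le> m")
  case True
  then have "{0..<m + 1} = insert m {0..<m}" by auto
  then show ?thesis using True by (simp add: height_def)
next
  case False
  then have "{m..<0} = insert m {m + 1..<0}" by auto
  then show ?thesis using False by (auto simp: height_def)
qed

section \<open>Lifting along the code of a graph\<close>

locale graph_without_sinks = fin_digraph G + nomulti_digraph G
  for G :: "('v, 'e) pre_digraph" +
  assumes no_sinks: "v \<in> verts G \<Longrightarrow> out_arcs G v \<noteq> {}"
begin

abbreviation "edge_paths \<equiv> infinite_paths (arcs G) (edge_matrix G)"
abbreviation "vertex_paths \<equiv> infinite_paths (verts G) (vertex_matrix G)"
abbreviation "edge_act \<equiv> dyck_act (arcs G) (edge_matrix G)"
abbreviation "vertex_act \<equiv> dyck_act (verts G) (vertex_matrix G)"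
abbreviation "edge_step \<equiv> dyck_step (arcs G) (edge_matrix G)"
abbreviation "vertex_step \<equiv> dyck_step (verts G) (vertex_matrix G)"

sublocale E: ck_matrix "arcs G" "edge_matrix G"
proof
  fix e assume "e \<in> arcs G"
  then obtain f where "f \<in> out_arcs G (head G e)" using no_sinks[OF head_in_verts] by blast
  then show "\<exists>f\<in>arcs G. edge_matrix G e f = 1" by (auto simp: edge_matrix_def eq_commute)
qed (auto simp: edge_matrix_def)

sublocale V: ck_matrix "verts G" "vertex_matrix G"
proof
  fix v assume "v \<in> verts G"
  then obtain e where "e \<in> out_arcs G v" using no_sinks by blast
  then show "\<exists>u\<in>verts G. vertex_matrix G v u = 1" by (auto simp: vertex_matrix_def)
qed (auto simp: vertex_matrix_def)

lemma edge_paths_iff: "x \<in> edge_paths \<longleftrightarrow> (\<forall>n. x n \<in> arcs G \<and> head G (x n) = tail G (x (Suc n)))"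
  by (auto simp: infinite_paths_def edge_matrix_def)

lemma tails_vertex_paths: "x \<in> edge_paths \<Longrightarrow> tail G \<circ> x \<in> vertex_paths"
  unfolding edge_paths_iff by (auto simp: infinite_paths_def vertex_matrix_def)

text \<open>
  With \<open>tails_vertex_paths\<close>, this makes edge paths and vertex paths correspond through
  their tails.
\<close>

lemma vertex_path_lift:
  assumes "y \<in> vertex_paths"
  shows "\<exists>x\<in>edge_paths. tail G \<circ> x = y"
proof -
  have "\<forall>n. \<exists>e. e \<in> arcs G \<and> tail G e = y n \<and> head G e = y (Suc n)"
  proof
    fix n
    have "vertex_matrix G (y n) (y (Suc n)) = 1" using assms by (simp add: infinite_paths_def)
    then show "\<exists>e. e \<in> arcs G \<and> tail G e = y n \<and> head G e = y (Suc n)"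
      by (auto simp: vertex_matrix_def split: if_splits)
  qed
  then obtain x where "\<And>n. x n \<in> arcs G \<and> tail G (x n) = y n \<and> head G (x n) = y (Suc n)"
    by metis
  then have "x \<in> edge_paths" "tail G \<circ> x = y" by (auto simp: edge_paths_iff)
  then show ?thesis by blast
qed

lemma step_edge_to_vertex:
  assumes "x \<in> edge_paths" "edge_step s x = Some x'"
  shows "vertex_step (edge_to_vertex G s) (tail G \<circ> x) = Some (tail G \<circ> x')"
proof (cases s)
  case (Beta e)
  then have e: "e \<in> arcs G" "head G e = tail G (x 0)" "x' = case_nat e x"
    using assms(2) by (auto simp: edge_matrix_def split: if_splits)
  then have "tail G \<circ> x' = case_nat (tail G e) (tail G \<circ> x)"
    by (auto split: nat.split)
  with e Beta show ?thesis by (auto simp: vertex_matrix_def)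
next
  case (Alpha e)
  then show ?thesis using assms(2) by (auto simp: comp_def split: if_splits)
qed

lemma act_edge_to_vertex:
  assumes "x \<in> edge_paths" "edge_act w x = Some x'"
  shows "vertex_act (map (edge_to_vertex G) w) (tail G \<circ> x) = Some (tail G \<circ> x')"
  using assms(2)
proof (induction w arbitrary: x')
  case (Cons s w)
  then obtain x1 where "edge_act w x = Some x1" "edge_step s x1 = Some x'"
    by (auto simp: bind_eq_Some_conv)
  then show ?case
    using Cons.IH[of x1] step_edge_to_vertex[of x1 s x'] act_paths[OF assms(1)]
    by (simp only: list.map dyck_act.simps Option.bind.simps)
qed simp

lemma legal_edge_to_vertex:
  "legal (arcs G) (edge_matrix G) w \<Longrightarrow> legal (verts G) (vertex_matrix G) (map (edge_to_vertex G) w)"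
  unfolding legal_def using act_edge_to_vertex tails_vertex_paths by blast

text \<open>
  A vertex \<open>v\<close> to be prepended lifts to an edge from \<open>v\<close> to the start of the path, and a vertex to be
  removed lifts to the first edge of the path.
\<close>

lemma step_lift:
  assumes "x \<in> edge_paths" "vertex_step s (tail G \<circ> x) = Some y"
  shows "\<exists>s'\<in>dyck_alphabet (arcs G). \<exists>x'. edge_to_vertex G s' = s \<and> edge_step s' x = Some x' \<and> tail G \<circ> x' = y"
proof (cases s)
  case (Beta v)
  then have "vertex_matrix G v (tail G (x 0)) = 1" and y: "y = case_nat v (tail G \<circ> x)"
    using assms(2) by (auto split: if_splits)
  then obtain e where e: "e \<in> arcs G" "tail G e = v" "head G e = tail G (x 0)"
    by (auto simp: vertex_matrix_def split: if_splits)
  then have "tail G \<circ> case_nat e x = y" unfolding y by (auto split: nat.split)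
  with e Beta show ?thesis
    by (intro bexI[of _ "Beta e"] exI[of _ "case_nat e x"]) (auto simp: edge_matrix_def dyck_alphabet_def)
next
  case (Alpha v)
  then have "tail G (x 0) = v" "y = tail G \<circ> x \<circ> Suc" using assms(2) by (auto split: if_splits)
  moreover have "x 0 \<in> arcs G" using assms(1) by (simp add: edge_paths_iff)
  ultimately show ?thesis
    using Alpha by (intro bexI[of _ "Alpha (x 0)"] exI[of _ "x \<circ> Suc"]) (auto simp: dyck_alphabet_def)
qed

lemma act_lift:
  assumes "x \<in> edge_paths" "vertex_act w (tail G \<circ> x) = Some y"
  shows "\<exists>w'\<in>lists (dyck_alphabet (arcs G)). \<exists>x'.
    map (edge_to_vertex G) w' = w \<and> edge_act w' x = Some x' \<and> tail G \<circ> x' = y"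
  using assms(2)
proof (induction w arbitrary: y)
  case Nil
  then show ?case by (intro bexI[of _ "[]"]) auto
next
  case (Cons s w)
  then obtain y1 where "vertex_act w (tail G \<circ> x) = Some y1" and s: "vertex_step s y1 = Some y"
    by (auto simp only: dyck_act.simps bind_eq_Some_conv)
  with Cons.IH obtain w' x1 where w': "w' \<in> lists (dyck_alphabet (arcs G))"
    "map (edge_to_vertex G) w' = w" "edge_act w' x = Some x1" "tail G \<circ> x1 = y1"
    by blast
  moreover have "x1 \<in> edge_paths" using act_paths assms(1) w'(3) by metis
  ultimately obtain s' x' where "s' \<in> dyck_alphabet (arcs G)" "edge_to_vertex G s' = s"
    "edge_step s' x1 = Some x'" "tail G \<circ> x' = y"
    using step_lift[of x1 s y] s by blast
  with w' show ?case by (intro bexI[of _ "s' # w'"] exI[of _ x']) auto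
qed

lemma legal_lift:
  assumes "legal (verts G) (vertex_matrix G) w"
  shows "\<exists>w'\<in>lists (dyck_alphabet (arcs G)).
    map (edge_to_vertex G) w' = w \<and> legal (arcs G) (edge_matrix G) w'"
proof -
  obtain v y where "v \<in> vertex_paths" "vertex_act w v = Some y"
    using assms by (auto simp: legal_def)
  moreover then obtain x where "x \<in> edge_paths" "tail G \<circ> x = v"
    using vertex_path_lift by blast
  ultimately show ?thesis using act_lift[of x w y] unfolding legal_def by blast
qed

lemma edge_to_vertex_alphabet:
  "s \<in> dyck_alphabet (arcs G) \<Longrightarrow> edge_to_vertex G s \<in> dyck_alphabet (verts G)"
  by (auto simp: dyck_alphabet_def)

lemma block_code: "block (edge_to_vertex_code G x) i j = map (edge_to_vertex G) (block x i j)"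
  by (simp add: block_def edge_to_vertex_code_def)

lemma edge_shift_iff:
  "x \<in> edge_shift G \<longleftrightarrow> range x \<subseteq> dyck_alphabet (arcs G) \<and>
    (\<forall>i j. i \<le> j \<longrightarrow> legal (arcs G) (edge_matrix G) (block x i j))"
  by (simp add: edge_shift_def E.markov_dyck_iff)

lemma vertex_shift_iff:
  "y \<in> vertex_shift G \<longleftrightarrow> range y \<subseteq> dyck_alphabet (verts G) \<and>
    (\<forall>i j. i \<le> j \<longrightarrow> legal (verts G) (vertex_matrix G) (block y i j))"
  by (simp add: vertex_shift_def V.markov_dyck_iff)

lemma code_into: "x \<in> edge_shift G \<Longrightarrow> edge_to_vertex_code G x \<in> vertex_shift G"
  unfolding edge_shift_iff vertex_shift_iff block_code
  by (auto intro: legal_edge_to_vertex)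
    (auto simp: edge_to_vertex_code_def intro!: edge_to_vertex_alphabet)

text \<open>
  Every central block of \<open>y\<close> has a legal lift; a limit of these lifts is legal because
  legality is inherited by factors.
\<close>

lemma code_onto:
  assumes y: "y \<in> vertex_shift G"
  shows "\<exists>x\<in>edge_shift G. edge_to_vertex_code G x = y"
proof -
  define lifts where "lifts m x \<longleftrightarrow> range x \<subseteq> dyck_alphabet (arcs G) \<and>
      legal (arcs G) (edge_matrix G) (block x (- int m) (int m)) \<and>
      (\<forall>k. \<bar>k\<bar> \<le> int m \<longrightarrow> edge_to_vertex G (x k) = y k)" for m x
  have "\<exists>x. lifts m x" for m
  proof -
    have "legal (verts G) (vertex_matrix G) (block y (- int m) (int m))"
      using y by (simp add: vertex_shift_iff)
    then obtain w where w: "w \<in> lists (dyck_alphabet (arcs G))"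
      "map (edge_to_vertex G) w = block y (- int m) (int m)" "legal (arcs G) (edge_matrix G) w"
      using legal_lift by blast
    \<comment> \<open>Outside the block, any letter of the alphabet will do; \<open>w\<close> is not empty.\<close>
    define x where "x k = w ! (if \<bar>k\<bar> \<le> int m then nat (k + int m) else 0)" for k
    have len: "length w = 2 * m + 1"
      using arg_cong[OF w(2), of length] by (simp add: block_def)
    have "block x (- int m) (int m) = w"
      by (rule nth_equalityI) (auto simp: block_def len x_def)
    moreover have "range x \<subseteq> dyck_alphabet (arcs G)"
      using w(1) len by (auto simp: x_def in_lists_conv_set intro!: nth_mem)
    moreover have "edge_to_vertex G (x k) = y k" if "\<bar>k\<bar> \<le> int m" for k
    proof -
      have "map (edge_to_vertex G) (block x (- int m) (int m)) = block y (- int m) (int m)"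
        using w(2) \<open>block x (- int m) (int m) = w\<close> by simp
      moreover have "k \<in> set [- int m..int m]" using that by auto
      ultimately show ?thesis unfolding block_def map_map by (auto simp del: set_upto)
    qed
    ultimately have "lifts m x" using w(3) by (simp add: lifts_def)
    then show ?thesis by blast
  qed
  then obtain x where "\<And>m. lifts m (x m)" by metis
  then have x: "\<And>m. range (x m) \<subseteq> dyck_alphabet (arcs G)"
    "\<And>m. legal (arcs G) (edge_matrix G) (block (x m) (- int m) (int m))"
    "\<And>m k. \<bar>k\<bar> \<le> int m \<Longrightarrow> edge_to_vertex G (x m k) = y k"
    by (simp_all add: lifts_def)
  have "finite (dyck_alphabet (arcs G))" by (simp add: dyck_alphabet_def)
  from full_shift_compact[OF this x(1)]
  obtain z where z: "\<forall>n. \<exists>m\<ge>n. \<forall>k. \<bar>k\<bar> \<le> int n \<longrightarrow> z k = x m k" ..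
  have "z k \<in> dyck_alphabet (arcs G) \<and> edge_to_vertex G (z k) = y k" for k
  proof -
    obtain m where "m \<ge> nat \<bar>k\<bar>" "z k = x m k" using spec[OF z, of "nat \<bar>k\<bar>"] by auto
    then show ?thesis using x(1)[of m] x(3)[of k m] by auto
  qed
  moreover have "legal (arcs G) (edge_matrix G) (block z i j)" if "i \<le> j" for i j
  proof -
    define n where "n = nat (max \<bar>i\<bar> \<bar>j\<bar>)"
    obtain m where m: "m \<ge> n" "\<And>k. \<bar>k\<bar> \<le> int n \<Longrightarrow> z k = x m k" using z by blast
    have "block z i j = block (x m) i j"
    proof (rule block_cong)
      fix k assume "i \<le> k" "k \<le> j"
      then have "\<bar>k\<bar> \<le> int n" by (auto simp: n_def)
      then show "z k = x m k" by (rule m(2))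
    qed
    moreover have "- int m \<le> i" "j \<le> int m" using m(1) by (auto simp: n_def)
    ultimately show ?thesis
      using x(2)[of m] legal_factor unfolding block_factor[OF \<open>- int m \<le> i\<close> that \<open>j \<le> int m\<close>]
      by metis
  qed
  ultimately have "z \<in> edge_shift G" "edge_to_vertex_code G z = y"
    by (auto simp: edge_shift_iff edge_to_vertex_code_def)
  then show ?thesis by blast
qed

section \<open>Heights and fibers\<close>

text \<open>
  The vertices of a symbol are the starting points of the paths after and before its action.
\<close>

lemma step_vertices:
  assumes "z \<in> edge_paths" "edge_step s z = Some z'"
  shows "initial_vertex G s = tail G (z' 0)" "final_vertex G s = tail G (z 0)"
proof -
  have "head G (z 0) = tail G (z 1)" using assms(1) by (simp add: edge_paths_iff)
  have "initial_vertex G s = tail G (z' 0) \<and> final_vertex G s = tail G (z 0)"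
  proof (cases s)
    case (Beta e)
    then have "head G e = tail G (z 0)" "z' = case_nat e z"
      using assms(2) by (simp_all add: edge_matrix_def split: if_splits)
    then show ?thesis using Beta by simp
  next
    case (Alpha e)
    then have "z 0 = e" "z' = z \<circ> Suc"
      using assms(2) by (simp_all split: if_splits)
    then show ?thesis using Alpha \<open>head G (z 0) = tail G (z 1)\<close> by simp
  qed
  then show "initial_vertex G s = tail G (z' 0)" "final_vertex G s = tail G (z 0)" by simp_all
qed

lemma final_eq_initial:
  assumes "x \<in> edge_shift G"
  shows "final_vertex G (x k) = initial_vertex G (x (k + 1))"
proof -
  have "legal (arcs G) (edge_matrix G) (block x k (k + 1))"
    using assms unfolding edge_shift_iff by simp
  moreover have "block x k (k + 1) = [x k, x (k + 1)]"
    by (simp add: block_def upto_rec1)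
  ultimately obtain z z' z'' where z: "z \<in> edge_paths" "edge_step (x (k + 1)) z = Some z'"
    and z': "edge_step (x k) z' = Some z''"
    by (auto simp: legal_def bind_eq_Some_conv)
  have "z' \<in> edge_paths" using step_paths z .
  then show ?thesis
    using step_vertices(1)[OF z] step_vertices(2)[OF _ z'] by simp
qed

text \<open>
  Reading backwards from \<open>j\<close>, the word acts on a path \<open>z\<close> like on a stack: at position \<open>k\<close> there are
  \<open>height x k - height x j\<close> entries on top of \<open>z\<close>.  This number is never negative, so \<open>z\<close> is not touched,
  and at position \<open>i\<close> the path is \<open>z\<close> again.  The vertices at \<open>i\<close> and \<open>j\<close> are both the start of \<open>z\<close>.
\<close>

lemma return_vertex:
  assumes x: "x \<in> edge_shift G" and "i \<le> j" "height x i = height x j"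
    and above: "\<And>k. i \<le> k \<Longrightarrow> k \<le> j \<Longrightarrow> height x j \<le> height x k"
  shows "initial_vertex G (x i) = initial_vertex G (x j)"
proof (cases "i = j")
  case False
  then have ij: "i \<le> j - 1" using assms(2) by simp
  then have "legal (arcs G) (edge_matrix G) (block x i (j - 1))"
    using x by (simp add: edge_shift_iff)
  then obtain z y where z: "z \<in> edge_paths" and y: "edge_act (block x i (j - 1)) z = Some y"
    unfolding legal_def by blast
  have suffix: "\<exists>u. edge_act (block x k (j - 1)) z = Some u" if "i \<le> k" "k \<le> j" for k
  proof -
    have "block x i (j - 1) = block x i (k - 1) @ block x k (j - 1)"
      using that block_append[of i "k - 1" "j - 1" x] by simp
    then show ?thesis using y by (auto simp only: act_append bind_eq_Some_conv)
  qed
  have stack: "i \<le> k \<Longrightarrow> (\<exists>u\<in>edge_paths. edge_act (block x k (j - 1)) z = Some u \<and>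
      (\<forall>n. u (n + nat (height x k - height x j)) = z n))" if "k \<le> j" for k
    using that
  proof (induction k rule: int_le_induct)
    case base
    then show ?case using z by (simp add: block_def)
  next
    case (step k)
    then obtain u where u: "u \<in> edge_paths" "edge_act (block x k (j - 1)) z = Some u"
      "\<And>n. u (n + nat (height x k - height x j)) = z n"
      by auto
    have "block x (k - 1) (j - 1) = x (k - 1) # block x k (j - 1)"
      using step.hyps block_Cons[of "k - 1" "j - 1" x] by simp
    moreover obtain u' where "edge_act (block x (k - 1) (j - 1)) z = Some u'"
      using suffix[of "k - 1"] step.prems step.hyps by auto
    ultimately have u': "edge_step (x (k - 1)) u = Some u'" "edge_act (block x (k - 1) (j - 1)) z = Some u'"
      using u(2) by simp_all
    have h: "height x k = height x (k - 1) + chi_minus (x (k - 1)) - chi_plus (x (k - 1))"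
      using height_Suc[of x "k - 1"] by simp
    have h_ge: "height x j \<le> height x (k - 1)" "height x j \<le> height x k"
      using above[of "k - 1"] above[of k] step.prems step.hyps by simp_all
    have "u' (n + nat (height x (k - 1) - height x j)) = z n" for n
    proof (cases "x (k - 1)")
      case (Beta e)
      then have "nat (height x (k - 1) - height x j) = Suc (nat (height x k - height x j))"
        using h h_ge by simp
      then show ?thesis using Beta u'(1) u(3)[of n] by (auto split: if_splits)
    next
      case (Alpha e)
      then have "nat (height x k - height x j) = Suc (nat (height x (k - 1) - height x j))"
        using h h_ge by simp
      then show ?thesis using Alpha u'(1) u(3)[of n] by (auto split: if_splits)
    qed
    then show ?case using u' step_paths u(1) by blast
  qed
  then have "\<exists>u. edge_act (block x i (j - 1)) z = Some u \<and> u 0 = z 0"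
    using assms(2,3) by force
  then have "y 0 = z 0" using y by simp
  obtain u where "edge_act (block x (i + 1) (j - 1)) z = Some u" "edge_step (x i) u = Some y"
    using y unfolding block_Cons[OF ij] dyck_act.simps bind_eq_Some_conv by blast
  then have "initial_vertex G (x i) = tail G (y 0)"
    using step_vertices(1) act_paths z by metis
  also obtain v where "edge_step (x (j - 1)) z = Some v"
    using suffix[of "j - 1"] ij by (auto simp: block_def)
  then have "tail G (z 0) = final_vertex G (x (j - 1))"
    using step_vertices(2) z by metis
  with \<open>y 0 = z 0\<close> have "tail G (y 0) = initial_vertex G (x j)"
    using final_eq_initial[OF x, of "j - 1"] by simp
  finally show ?thesis .
qed simp

lemma chi_edge_to_vertex:
  "chi_minus (edge_to_vertex G s) = chi_minus s" "chi_plus (edge_to_vertex G s) = chi_plus s"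
  by (cases s; simp)+

lemma height_code: "height (edge_to_vertex_code G x) m = height x m"
  by (simp add: height_def edge_to_vertex_code_def chi_edge_to_vertex)

lemma step_down: "height x (k + 1) < height x k \<longleftrightarrow> (\<exists>e. x k = Beta e)"
  using height_Suc[of x k] by (cases "x k") auto

lemma step_up: "height x k < height x (k + 1) \<longleftrightarrow> (\<exists>e. x k = Alpha e)"
  using height_Suc[of x k] by (cases "x k") auto

lemma step_size: "\<bar>height x (k + 1) - height x k\<bar> = 1"
  using height_Suc[of x k] by (cases "x k") auto

text \<open>
  Suppose the walk goes below \<open>height x k\<close> to the right of \<open>k\<close>, and let \<open>j\<close> be the position just before it
  first does so.  Then \<open>j\<close> has the height of \<open>k\<close> and therefore the same vertex, and this vertex is the tail
  of the descending edge at \<open>j\<close>, which the code shows.  The situation on the left is symmetric, with an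
  ascending step.  The two sequences have equal heights, so the argument applies to
  both with the same \<open>j\<close>.
\<close>

lemma vertex_determined:
  assumes x: "x \<in> edge_shift G" and x': "x' \<in> edge_shift G"
    and eq: "edge_to_vertex_code G x = edge_to_vertex_code G x'"
    and low: "height x n < height x k"
  shows "initial_vertex G (x k) = initial_vertex G (x' k)"
proof -
  have heights: "height x' m = height x m" for m
    using height_code[of x m] height_code[of x' m] eq by simp
  have sym: "edge_to_vertex G (x m) = edge_to_vertex G (x' m)" for m
    using fun_cong[OF eq, of m] by (simp add: edge_to_vertex_code_def)
  have beta: "initial_vertex G (x m) = initial_vertex G (x' m)" if "x m = Beta e" for m e
    using sym[of m] that by (cases "x' m") auto
  have alpha: "final_vertex G (x m) = final_vertex G (x' m)" if "x m = Alpha e" for m e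
    using sym[of m] that by (cases "x' m") auto
  consider "k < n" | "n < k" using low by force
  then show ?thesis
  proof cases
    case 1
    then have "height x (k + int (nat (n - k))) < height x k" using low by simp
    then obtain d where d: "height x (k + int d) < height x k"
      "\<And>d'. d' < d \<Longrightarrow> height x k \<le> height x (k + int d')"
      using exists_least_iff[of "\<lambda>d. height x (k + int d) < height x k"] by (metis not_less)
    define j where "j = k + int d - 1"
    have "d \<noteq> 0" using d(1) by (intro notI) simp
    then have "k \<le> j" by (simp add: j_def)
    have above: "height x k \<le> height x m" if "k \<le> m" "m \<le> j" for m
      using d(2)[of "nat (m - k)"] that by (simp add: j_def)
    have "height x (j + 1) < height x k" using d(1) by (simp add: j_def)
    then have j: "height x k = height x j" "height x (j + 1) < height x j"
      using step_size[of x j] above[OF \<open>k \<le> j\<close>] by auto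
    have "initial_vertex G (x k) = initial_vertex G (x j)"
      using j(1) above \<open>k \<le> j\<close> by (intro return_vertex x) auto
    also have "\<dots> = initial_vertex G (x' j)"
    proof -
      obtain e where "x j = Beta e" using j(2) unfolding step_down by blast
      then show ?thesis by (rule beta)
    qed
    also have "\<dots> = initial_vertex G (x' k)"
      using j(1) above \<open>k \<le> j\<close> by (intro return_vertex[symmetric] x') (auto simp: heights)
    finally show ?thesis .
  next
    case 2
    then have "height x (k - int (nat (k - n))) < height x k" using low by simp
    then obtain d where d: "height x (k - int d) < height x k"
      "\<And>d'. d' < d \<Longrightarrow> height x k \<le> height x (k - int d')"
      using exists_least_iff[of "\<lambda>d. height x (k - int d) < height x k"] by (metis not_less)
    define i where "i = k - int d"
    have "d \<noteq> 0" using d(1) by (intro notI) simp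
    then have "i + 1 \<le> k" by (simp add: i_def)
    have above: "height x k \<le> height x m" if "i + 1 \<le> m" "m \<le> k" for m
      using d(2)[of "nat (k - m)"] that by (simp add: i_def)
    have "height x i < height x k" using d(1) by (simp add: i_def)
    then have i: "height x (i + 1) = height x k" "height x i < height x (i + 1)"
      using step_size[of x i] above[OF _ \<open>i + 1 \<le> k\<close>] by auto
    have "initial_vertex G (x k) = initial_vertex G (x (i + 1))"
      using i(1) above \<open>i + 1 \<le> k\<close> by (intro return_vertex[symmetric] x) auto
    also have "\<dots> = initial_vertex G (x' (i + 1))"
    proof -
      obtain e where "x i = Alpha e" using i(2) unfolding step_up by blast
      then have "final_vertex G (x i) = final_vertex G (x' i)" by (rule alpha)
      then show ?thesis using final_eq_initial[OF x, of i] final_eq_initial[OF x', of i] by simp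
    qed
    also have "\<dots> = initial_vertex G (x' k)"
      using i(1) above \<open>i + 1 \<le> k\<close> by (intro return_vertex x') (auto simp: heights)
    finally show ?thesis .
  qed
qed

text \<open>
  The vertices before and after a step are the ends of its edge; without multi-edges they
  determine the edge.
\<close>

lemma eq_if_vertices_eq:
  assumes x: "x \<in> edge_shift G" and x': "x' \<in> edge_shift G"
    and eq: "edge_to_vertex_code G x = edge_to_vertex_code G x'"
    and vertices: "\<And>k. initial_vertex G (x k) = initial_vertex G (x' k)"
  shows "x = x'"
proof
  fix k
  have alphabet: "x k \<in> dyck_alphabet (arcs G)" "x' k \<in> dyck_alphabet (arcs G)"
    using x x' by (auto simp: edge_shift_iff)
  have symbol: "edge_to_vertex G (x k) = edge_to_vertex G (x' k)"
    using fun_cong[OF eq, of k] by (simp add: edge_to_vertex_code_def)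
  have final: "final_vertex G (x k) = final_vertex G (x' k)"
    using final_eq_initial[OF x, of k] final_eq_initial[OF x', of k] vertices[of "k + 1"] by simp
  show "x k = x' k"
  proof (cases "x k")
    case (Beta e)
    with symbol obtain e' where "x' k = Beta e'" by (cases "x' k") auto
    then show ?thesis
      using Beta alphabet vertices[of k] final no_multi_arcs[of e e']
      by (auto simp: dyck_alphabet_def arc_to_ends_def)
  next
    case (Alpha e)
    with symbol obtain e' where "x' k = Alpha e'" by (cases "x' k") auto
    then show ?thesis
      using Alpha alphabet vertices[of k] final no_multi_arcs[of e e']
      by (auto simp: dyck_alphabet_def arc_to_ends_def)
  qed
qed

lemma has_minimum_vertex_iff:
  "has_minimum_vertex G x \<longleftrightarrow> (\<exists>m. \<forall>n. height x m \<le> height x n)"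
  by (auto simp: has_minimum_vertex_def minimum_vertices_def)

lemma fiber_singleton:
  assumes "x \<in> edge_shift G" "\<not> has_minimum_vertex G x"
  shows "fiber (edge_to_vertex_code G) (edge_shift G) (edge_to_vertex_code G x) = {x}"
proof -
  have "x' = x" if "x' \<in> edge_shift G" "edge_to_vertex_code G x' = edge_to_vertex_code G x" for x'
  proof (rule eq_if_vertices_eq[symmetric])
    fix k
    obtain n where "height x n < height x k"
      using assms(2) by (auto simp: has_minimum_vertex_iff not_le)
    then show "initial_vertex G (x k) = initial_vertex G (x' k)"
      using assms(1) that by (intro vertex_determined) auto
  qed (use assms(1) that in auto)
  then show ?thesis using assms(1) by (auto simp: fiber_def)
qed

text \<open>
  The vertex at one position \<open>m\<close> of minimal height determines the point of the fiber: other
  positions of minimal height carry the same vertex by \<open>return_vertex\<close>, and the remaining vertices are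
  determined by the image.
\<close>

lemma fiber_card_le:
  assumes "x \<in> edge_shift G" "has_minimum_vertex G x"
  defines "F \<equiv> fiber (edge_to_vertex_code G) (edge_shift G) (edge_to_vertex_code G x)"
  shows "finite F" "card F \<le> card (verts G)"
proof -
  obtain m where m: "\<And>n. height x m \<le> height x n"
    using assms(2) by (auto simp: has_minimum_vertex_iff)
  have F: "u \<in> edge_shift G" "edge_to_vertex_code G u = edge_to_vertex_code G x"
    "\<And>n. height u n = height x n" if "u \<in> F" for u
  proof -
    show "u \<in> edge_shift G" and code: "edge_to_vertex_code G u = edge_to_vertex_code G x"
      using that by (simp_all add: F_def fiber_def)
    show "height u n = height x n" for n
      using height_code[of u n] height_code[of x n] code by simp
  qed
  have at_min: "initial_vertex G (u k) = initial_vertex G (u m)"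
    if u: "u \<in> F" and k: "height x k = height x m" for u k
  proof (cases "k \<le> m")
    case True
    show ?thesis
      by (rule return_vertex[OF F(1)[OF u] True]) (simp_all only: F(3)[OF u] k m)
  next
    case False
    then have "m \<le> k" by simp
    show ?thesis
      by (rule return_vertex[OF F(1)[OF u] \<open>m \<le> k\<close>, symmetric]) (simp_all only: F(3)[OF u] k m)
  qed
  have inj: "inj_on (\<lambda>u. initial_vertex G (u m)) F"
  proof (rule inj_onI)
    fix u v assume u: "u \<in> F" and v: "v \<in> F" and uv: "initial_vertex G (u m) = initial_vertex G (v m)"
    show "u = v"
    proof (rule eq_if_vertices_eq)
      fix k
      show "initial_vertex G (u k) = initial_vertex G (v k)"
      proof (cases "height x k = height x m")
        case True
        then show ?thesis using at_min[OF u True] at_min[OF v True] uv by simp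
      next
        case False
        then have "height u m < height u k" using m[of k] by (simp add: F(3)[OF u])
        moreover have "edge_to_vertex_code G u = edge_to_vertex_code G v"
          using F(2)[OF u] F(2)[OF v] by simp
        ultimately show ?thesis
          using vertex_determined[OF F(1)[OF u] F(1)[OF v]] by blast
      qed
    qed (use F(1,2)[OF u] F(1,2)[OF v] in auto)
  qed
  have "(\<lambda>u. initial_vertex G (u m)) ` F \<subseteq> verts G"
  proof
    fix w assume "w \<in> (\<lambda>u. initial_vertex G (u m)) ` F"
    then obtain u where u: "u \<in> F" "w = initial_vertex G (u m)" by blast
    have "u m \<in> dyck_alphabet (arcs G)" using F(1)[OF u(1)] unfolding edge_shift_iff by blast
    then show "w \<in> verts G" using u(2) by (auto simp: dyck_alphabet_def)
  qed
  then show "finite F" "card F \<le> card (verts G)"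
    using inj_on_finite[OF inj _ finite_verts] card_inj_on_le[OF inj _ finite_verts] by simp_all
qed

lemma factor_code: "factor_code (edge_shift G) (vertex_shift G) (edge_to_vertex_code G)"
proof -
  have "edge_to_vertex_code G x k = (edge_to_vertex G \<circ> hd) (block x (k - int 0) (k + int 0))" for x k
    by (simp add: edge_to_vertex_code_def block_def)
  then have "sliding_block_code (edge_shift G) (vertex_shift G) (edge_to_vertex_code G)"
    unfolding sliding_block_code_def using code_into by blast
  moreover have "edge_to_vertex_code G ` edge_shift G = vertex_shift G"
    using code_into code_onto by blast
  ultimately show ?thesis by (simp add: factor_code_def)
qed

lemma finite_to_one: "finite_to_one (edge_shift G) (vertex_shift G) (edge_to_vertex_code G)"
  unfolding finite_to_one_def
proof (intro exI ballI)
  fix y assume "y \<in> vertex_shift G"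
  then obtain x where x: "x \<in> edge_shift G" "edge_to_vertex_code G x = y" using code_onto by blast
  show "finite (fiber (edge_to_vertex_code G) (edge_shift G) y) \<and>
      card (fiber (edge_to_vertex_code G) (edge_shift G) y) \<le> max 1 (card (verts G))"
  proof (cases "has_minimum_vertex G x")
    case True
    then show ?thesis using fiber_card_le[OF x(1)] x(2) by auto
  next
    case False
    then show ?thesis using fiber_singleton[OF x(1)] x(2) by auto
  qed
qed

end

theorem proposition2p9:
  fixes G :: "('v, 'e) pre_digraph"
  assumes "fin_digraph G"
    and "nomulti_digraph G"
    and "\<And>v. v \<in> verts G \<Longrightarrow> in_arcs G v \<noteq> {} \<and> out_arcs G v \<noteq> {}"
  shows "factor_code (edge_shift G) (vertex_shift G) (edge_to_vertex_code G) \<and>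
    (\<forall>x\<in>edge_shift G.
      (\<not> has_minimum_vertex G x \<longrightarrow>
        fiber (edge_to_vertex_code G) (edge_shift G) (edge_to_vertex_code G x) = {x}) \<and>
      (has_minimum_vertex G x \<longrightarrow>
        finite (fiber (edge_to_vertex_code G) (edge_shift G) (edge_to_vertex_code G x)) \<and>
        card (fiber (edge_to_vertex_code G) (edge_shift G) (edge_to_vertex_code G x))
          \<le> card (verts G))) \<and>
    finite_to_one (edge_shift G) (vertex_shift G) (edge_to_vertex_code G)"
proof -
  interpret graph_without_sinks G
    using assms by (intro graph_without_sinks.intro graph_without_sinks_axioms.intro) auto
  show ?thesis
    using factor_code finite_to_one fiber_singleton fiber_card_le by blast
qed

end
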